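(* Let $C_\bullet$ be the bifiltered chain complex of a simplicial bifiltration $\mathcal K$, and let $G_i,R_i,p^1_i,f^0_i,f^1_i,h^0_i$ be the modules and maps of the path construction described in the context. Then the chain complex $$0\leftarrow G_0\xleftarrow{\begin{pmatrix} f^0_1 & p^1_0\end{pmatrix}} G_1\oplus R_0\xleftarrow{\begin{pmatrix} f^0_2 & p^1_1\\ h^0_2& f^1_1\end{pmatrix}} G_2\oplus R_1\xleftarrow{\begin{pmatrix} f^0_3 & p^1_2\\ h^0_3& f^1_2\end{pmatrix}}\cdots$$ with degree-$i$ module $G_i\oplus R_{i-1}$ is a free resolution of $C_\bullet$.
   Context: All vector spaces are over $\mathbb Z_2$; $\mathbb N^2$ carries the product order and $x\vee y$ is the coordinatewise maximum. A simplicial bifiltration $\mathcal K$ is a finite abstract simplicial complex with subcomplexes $(\mathcal K_s)_{s\in\mathbb N^2}$ such that $\mathcal K_s\subseteq\mathcal K_t$ whenever $s\le t$ (every simplex lies in some $\mathcal K_s$). For a simplex $\sigma$, $\mathrm{supp}(\sigma)=\{s:\sigma\in\mathcal K_s\}$ is an upset, and $\mathcal G(\sigma)$ is its finite set of minimal elements. A bipersistence module is a functor from $\mathbb N^2$ to vector spaces. $U_A$ denotes the upset module of $A\subseteq\mathbb N^2$ ($\mathbb Z_2$ at grades $s$ above some $a\in A$, $0$ elsewhere, identity structure maps inside the upset). A module is free if it is a direct sum of modules $U_{\{x\}}$; a basis element of grade $x$ generates a summand $U_{\{x\}}$. $U_\sigma=U_{\mathcal G(\sigma)}$. $C_i=\bigoplus_{\dim\sigma=i}U_\sigma$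 with simplicial boundary maps $\partial_i$. A free resolution of $C_\bullet$ is a chain complex $F_\bullet$ of free modules with a chain map $F_\bullet\to C_\bullet$ inducing isomorphisms on all homology modules. Path construction: for a simplex $\sigma$ let $\mathcal G(\sigma)=\{x_1,\dots,x_m\}$, ordered by first coordinate. $G_\sigma$ is free with basis $g_\sigma^{x_1},\dots,g_\sigma^{x_m}$ (generators, $g^{x_j}_\sigma$ of grade $x_j$); $R_\sigma$ is free with basis $r_\sigma^{y_1},\dots,r_\sigma^{y_{m-1}}$ (relations), $r_\sigma^{y_j}$ of grade $y_j=x_j\vee x_{j+1}$; $p^1_\sigma(r_\sigma^{y_j})=g_\sigma^{x_j}+g_\sigma^{x_{j+1}}$. $G_i,R_i,p^1_i$ are the direct sums over all $i$-simplices (zero for negative $i$). For two generators $g_\sigma^{x_j},g_\sigma^{x_\ell}$ of the same simplex, $j\le\ell$, the connecting path is $r_\sigma^{y_j}+\dots+r_\sigma^{y_{\ell-1}}$ (zero if $j=\ell$). $f^0_i:G_i\to G_{i-1}$ sends $g_\sigma^x$ to $\sum_\tau g_\tau^{z_\tau}$ over the facets $\tau$ of $\sigma$, where $z_\tau\in\mathcal G(\tau)$ is chosen with $z_\tau\le x$. $f^1_i:R_i\to R_{i-1}$ sends a relation of $\sigma$ with $p^1_i$-image $g+g'$ to the sum, over the facets $\tau$ of $\sigma$, of the path connecting the $\tau$-components of $f^0_i(g)$ and $f^0_i(g')$. $h^0_i:G_i\to R_{i-2}$ sends $g_\sigma^x$ to the sum, over codimension-2 faces $\tau$ of $\sigma$,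 of the path connecting the two generators of $\tau$ contributing to $f^0_{i-1}f^0_i(g_\sigma^x)$. *)

theory Defs
  imports
    "HOL-Algebra.Algebraic_Closure_Type"
    "HOL-Library.Z2"
    "HOL-Library.Product_Order"
    "HOL-Library.Function_Algebras"
begin

(* The order and supremum on nat * nat are the coordinatewise ones of Product_Order;
   zero and sums of functions are the pointwise ones of Function_Algebras. *)
type_synonym grade = "nat \<times> nat"

section \<open>Bipersistence modules\<close>

abbreviation Z2 :: "bit ring" where
  "Z2 \<equiv> ring_of_type_algebra"

definition linear_maps :: "(bit, 'a) module \<Rightarrow> (bit, 'b) module \<Rightarrow> ('a \<Rightarrow> 'b) set" where
  "linear_maps V W = {h \<in> carrier V \<rightarrow> carrier W.
     (\<forall>x\<in>carrier V. \<forall>y\<in>carrier V. h (x \<oplus>\<^bsub>V\<^esub> y) = h x \<oplus>\<^bsub>W\<^esub> h y) \<and>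
     (\<forall>a. \<forall>x\<in>carrier V. h (a \<odot>\<^bsub>V\<^esub> x) = a \<odot>\<^bsub>W\<^esub> h x)}"

record 'a pmodule =
  obj :: "grade \<Rightarrow> (bit, 'a) module"
  str :: "grade \<Rightarrow> grade \<Rightarrow> 'a \<Rightarrow> 'a"

(* str M s t is only meaningful for s \<le> t. *)
definition bipersistence_module :: "'a pmodule \<Rightarrow> bool" where
  "bipersistence_module M \<longleftrightarrow>
     (\<forall>s. Module.module Z2 (obj M s)) \<and>
     (\<forall>s t. s \<le> t \<longrightarrow> str M s t \<in> linear_maps (obj M s) (obj M t)) \<and>
     (\<forall>s. \<forall>x\<in>carrier (obj M s). str M s s x = x) \<and>
     (\<forall>s t u. s \<le> t \<longrightarrow> t \<le> u \<longrightarrow>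
        (\<forall>x\<in>carrier (obj M s). str M t u (str M s t x) = str M s u x))"

definition pmorphism :: "'a pmodule \<Rightarrow> 'b pmodule \<Rightarrow> (grade \<Rightarrow> 'a \<Rightarrow> 'b) \<Rightarrow> bool" where
  "pmorphism M N \<phi> \<longleftrightarrow>
     (\<forall>s. \<phi> s \<in> linear_maps (obj M s) (obj N s)) \<and>
     (\<forall>s t. s \<le> t \<longrightarrow> (\<forall>x\<in>carrier (obj M s). \<phi> t (str M s t x) = str N s t (\<phi> s x)))"

definition pisomorphism :: "'a pmodule \<Rightarrow> 'b pmodule \<Rightarrow> (grade \<Rightarrow> 'a \<Rightarrow> 'b) \<Rightarrow> bool" where
  "pisomorphism M N \<phi> \<longleftrightarrow>
     pmorphism M N \<phi> \<and> (\<forall>s. bij_betw (\<phi> s) (carrier (obj M s)) (carrier (obj N s)))"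

(* The vector spaces reuse the module record of HOL-Algebra, whose ring multiplication
   and unit play no role for modules; these two fields are filled arbitrarily throughout. *)
definition upset_module :: "grade set \<Rightarrow> bit pmodule" where
  "upset_module A = \<lparr>
     obj = (\<lambda>s. \<lparr>carrier = (if \<exists>a\<in>A. a \<le> s then UNIV else {0}),
                  monoid.mult = (*), one = 1, zero = 0, add = (+), module.smult = (*)\<rparr>),
     str = (\<lambda>s t x. x)\<rparr>"

definition direct_sum :: "'i set \<Rightarrow> ('i \<Rightarrow> 'a pmodule) \<Rightarrow> ('i \<Rightarrow> 'a) pmodule" where
  "direct_sum I M = \<lparr>
     obj = (\<lambda>s. \<lparr>carrier = {v. (\<forall>i\<in>I. v i \<in> carrier (obj (M i) s)) \<and>
                               (\<forall>i. i \<notin> I \<longrightarrow> v i = \<zero>\<^bsub>obj (M i) s\<^esub>) \<and>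
                               finite {i. v i \<noteq> \<zero>\<^bsub>obj (M i) s\<^esub>}},
                  monoid.mult = undefined, one = undefined,
                  zero = (\<lambda>i. \<zero>\<^bsub>obj (M i) s\<^esub>),
                  add = (\<lambda>v w i. v i \<oplus>\<^bsub>obj (M i) s\<^esub> w i),
                  module.smult = (\<lambda>a v i. a \<odot>\<^bsub>obj (M i) s\<^esub> v i)\<rparr>),
     str = (\<lambda>s t v i. str (M i) s t (v i))\<rparr>"

definition direct_sum2 :: "'a pmodule \<Rightarrow> 'b pmodule \<Rightarrow> ('a \<times> 'b) pmodule" where
  "direct_sum2 M N = \<lparr>
     obj = (\<lambda>s. \<lparr>carrier = carrier (obj M s) \<times> carrier (obj N s),
                  monoid.mult = undefined, one = undefined,
                  zero = (\<zero>\<^bsub>obj M s\<^esub>, \<zero>\<^bsub>obj N s\<^esub>),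
                  add = (\<lambda>(v, w) (v', w'). (v \<oplus>\<^bsub>obj M s\<^esub> v', w \<oplus>\<^bsub>obj N s\<^esub> w')),
                  module.smult = (\<lambda>a (v, w). (a \<odot>\<^bsub>obj M s\<^esub> v, a \<odot>\<^bsub>obj N s\<^esub> w))\<rparr>),
     str = (\<lambda>s t (v, w). (str M s t v, str N s t w))\<rparr>"

definition free_on :: "'i set \<Rightarrow> ('i \<Rightarrow> grade) \<Rightarrow> ('i \<Rightarrow> bit) pmodule" where
  "free_on B gr = direct_sum B (\<lambda>b. upset_module {gr b})"

(* Indexing by pairs (grade, element) is no restriction: the summands of a direct sum
   decomposition into modules U_{x} correspond to their generators, each of which is an
   element of M at some grade. *)
definition free_pmodule :: "'a pmodule \<Rightarrow> bool" where
  "free_pmodule M \<longleftrightarrow>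
     (\<exists>(B :: (grade \<times> 'a) set) gr \<phi>. pisomorphism (free_on B gr) M \<phi>)"

section \<open>Chain complexes and homology\<close>

record 'a pcomplex =
  cmod :: "int \<Rightarrow> 'a pmodule"
  cdiff :: "int \<Rightarrow> grade \<Rightarrow> 'a \<Rightarrow> 'a"  (* cdiff C i maps degree i to degree i - 1 *)

definition chain_complex :: "'a pcomplex \<Rightarrow> bool" where
  "chain_complex C \<longleftrightarrow>
     (\<forall>i. bipersistence_module (cmod C i)) \<and>
     (\<forall>i. pmorphism (cmod C i) (cmod C (i - 1)) (cdiff C i)) \<and>
     (\<forall>i s. \<forall>x\<in>carrier (obj (cmod C i) s).
        cdiff C (i - 1) s (cdiff C i s x) = \<zero>\<^bsub>obj (cmod C (i - 2)) s\<^esub>)"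

definition chain_map ::
  "'a pcomplex \<Rightarrow> 'b pcomplex \<Rightarrow> (int \<Rightarrow> grade \<Rightarrow> 'a \<Rightarrow> 'b) \<Rightarrow> bool" where
  "chain_map C D \<phi> \<longleftrightarrow>
     chain_complex C \<and> chain_complex D \<and>
     (\<forall>i. pmorphism (cmod C i) (cmod D i) (\<phi> i)) \<and>
     (\<forall>i s. \<forall>x\<in>carrier (obj (cmod C i) s).
        \<phi> (i - 1) s (cdiff C i s x) = cdiff D i s (\<phi> i s x))"

definition cycles :: "'a pcomplex \<Rightarrow> int \<Rightarrow> grade \<Rightarrow> 'a set" where
  "cycles C i s = a_kernel (obj (cmod C i) s) (obj (cmod C (i - 1)) s) (cdiff C i s)"

definition boundaries :: "'a pcomplex \<Rightarrow> int \<Rightarrow> grade \<Rightarrow> 'a set" where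
  "boundaries C i s = cdiff C (i + 1) s ` carrier (obj (cmod C (i + 1)) s)"

definition quotient_module :: "(bit, 'a) module \<Rightarrow> 'a set \<Rightarrow> (bit, 'a set) module" where
  "quotient_module V N =
     \<lparr>carrier = a_rcosets\<^bsub>V\<^esub> N,
      monoid.mult = undefined, one = undefined, zero = N,
      add = (<+>\<^bsub>V\<^esub>),
      module.smult = (\<lambda>a S. \<Union>x\<in>S. N +>\<^bsub>V\<^esub> (a \<odot>\<^bsub>V\<^esub> x))\<rparr>"

definition homology :: "'a pcomplex \<Rightarrow> int \<Rightarrow> 'a set pmodule" where
  "homology C i = \<lparr>
     obj = (\<lambda>s. quotient_module ((obj (cmod C i) s)\<lparr>carrier := cycles C i s\<rparr>) (boundaries C i s)),
     str = (\<lambda>s t S. \<Union>x\<in>S. boundaries C i t +>\<^bsub>obj (cmod C i) t\<^esub> str (cmod C i) s t x)\<rparr>"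

definition homology_map ::
  "'b pcomplex \<Rightarrow> (int \<Rightarrow> grade \<Rightarrow> 'a \<Rightarrow> 'b) \<Rightarrow> int \<Rightarrow> grade \<Rightarrow> 'a set \<Rightarrow> 'b set" where
  "homology_map D \<phi> i s S = (\<Union>x\<in>S. boundaries D i s +>\<^bsub>obj (cmod D i) s\<^esub> \<phi> i s x)"

definition free_resolution :: "'a pcomplex \<Rightarrow> 'b pcomplex \<Rightarrow> bool" where
  "free_resolution F C \<longleftrightarrow>
     chain_complex F \<and> (\<forall>i. free_pmodule (cmod F i)) \<and>
     (\<exists>\<phi>. chain_map F C \<phi> \<and>
        (\<forall>i. pisomorphism (homology F i) (homology C i) (homology_map C \<phi> i)))"

section \<open>Simplicial bifiltrations\<close>

definition abstract_complex :: "'v set set \<Rightarrow> bool" where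
  "abstract_complex K \<longleftrightarrow>
     (\<forall>\<sigma>\<in>K. finite \<sigma> \<and> \<sigma> \<noteq> {}) \<and> (\<forall>\<sigma>\<in>K. \<forall>\<tau>. \<tau> \<noteq> {} \<and> \<tau> \<subseteq> \<sigma> \<longrightarrow> \<tau> \<in> K)"

definition simplicial_bifiltration :: "'v set set \<Rightarrow> (grade \<Rightarrow> 'v set set) \<Rightarrow> bool" where
  "simplicial_bifiltration K Ks \<longleftrightarrow>
     finite K \<and> abstract_complex K \<and>
     (\<forall>s. abstract_complex (Ks s) \<and> Ks s \<subseteq> K) \<and>
     (\<forall>s t. s \<le> t \<longrightarrow> Ks s \<subseteq> Ks t) \<and>
     (\<forall>\<sigma>\<in>K. \<exists>s. \<sigma> \<in> Ks s)"

(* There are no simplices of dimension -1, as simplices are nonempty. *)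
definition simplices :: "'v set set \<Rightarrow> int \<Rightarrow> 'v set set" where
  "simplices K i = {\<sigma> \<in> K. int (card \<sigma>) - 1 = i}"

definition facets :: "'v set \<Rightarrow> 'v set set" where
  "facets \<sigma> = {\<tau>. \<tau> \<noteq> {} \<and> \<tau> \<subseteq> \<sigma> \<and> card \<tau> + 1 = card \<sigma>}"

definition codim2_faces :: "'v set \<Rightarrow> 'v set set" where
  "codim2_faces \<sigma> = {\<tau>. \<tau> \<noteq> {} \<and> \<tau> \<subseteq> \<sigma> \<and> card \<tau> + 2 = card \<sigma>}"

definition supp :: "(grade \<Rightarrow> 'v set set) \<Rightarrow> 'v set \<Rightarrow> grade set" where
  "supp Ks \<sigma> = {s. \<sigma> \<in> Ks s}"

definition min_grades :: "(grade \<Rightarrow> 'v set set) \<Rightarrow> 'v set \<Rightarrow> grade set" where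
  "min_grades Ks \<sigma> = {s \<in> supp Ks \<sigma>. \<forall>t \<in> supp Ks \<sigma>. t \<le> s \<longrightarrow> t = s}"

definition unit_vec :: "'b \<Rightarrow> 'b \<Rightarrow> bit" where
  "unit_vec b = (\<lambda>c. of_bool (c = b))"

definition linear_extension :: "'b set \<Rightarrow> ('b \<Rightarrow> 'c \<Rightarrow> bit) \<Rightarrow> ('b \<Rightarrow> bit) \<Rightarrow> 'c \<Rightarrow> bit" where
  "linear_extension B f v = (\<lambda>c. \<Sum>b\<in>B. v b * f b c)"

definition bifiltered_complex ::
  "'v set set \<Rightarrow> (grade \<Rightarrow> 'v set set) \<Rightarrow> ('v set \<Rightarrow> bit) pcomplex" where
  "bifiltered_complex K Ks = \<lparr>
     cmod = (\<lambda>i. direct_sum (simplices K i) (\<lambda>\<sigma>. upset_module (min_grades Ks \<sigma>))),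
     cdiff = (\<lambda>i s. linear_extension (simplices K i) (\<lambda>\<sigma>. \<Sum>\<tau>\<in>facets \<sigma>. unit_vec \<tau>))\<rparr>"

section \<open>The path construction\<close>

(* The list x_1, ..., x_m; positions in it are counted from 0. *)
definition gen_grades :: "(grade \<Rightarrow> 'v set set) \<Rightarrow> 'v set \<Rightarrow> grade list" where
  "gen_grades Ks \<sigma> = sorted_key_list_of_set fst (min_grades Ks \<sigma>)"

definition gen_grade :: "(grade \<Rightarrow> 'v set set) \<Rightarrow> 'v set \<times> nat \<Rightarrow> grade" where
  "gen_grade Ks = (\<lambda>(\<sigma>, j). gen_grades Ks \<sigma> ! j)"

definition rel_grade :: "(grade \<Rightarrow> 'v set set) \<Rightarrow> 'v set \<times> nat \<Rightarrow> grade" where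
  "rel_grade Ks = (\<lambda>(\<sigma>, j). sup (gen_grades Ks \<sigma> ! j) (gen_grades Ks \<sigma> ! Suc j))"

(* A generator or relation is named by its simplex and its position: as a generator,
   (\<sigma>, j) has the grade at position j of gen_grades Ks \<sigma>, and as a relation, (\<sigma>, j) relates
   the generators (\<sigma>, j) and (\<sigma>, j + 1). *)
definition gen_basis :: "'v set set \<Rightarrow> (grade \<Rightarrow> 'v set set) \<Rightarrow> int \<Rightarrow> ('v set \<times> nat) set" where
  "gen_basis K Ks i = (SIGMA \<sigma>:simplices K i. {j. j < length (gen_grades Ks \<sigma>)})"

definition rel_basis :: "'v set set \<Rightarrow> (grade \<Rightarrow> 'v set set) \<Rightarrow> int \<Rightarrow> ('v set \<times> nat) set" where
  "rel_basis K Ks i = (SIGMA \<sigma>:simplices K i. {j. j + 1 < length (gen_grades Ks \<sigma>)})"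

definition gen_module ::
  "'v set set \<Rightarrow> (grade \<Rightarrow> 'v set set) \<Rightarrow> int \<Rightarrow> ('v set \<times> nat \<Rightarrow> bit) pmodule" where
  "gen_module K Ks i = free_on (gen_basis K Ks i) (gen_grade Ks)"

definition rel_module ::
  "'v set set \<Rightarrow> (grade \<Rightarrow> 'v set set) \<Rightarrow> int \<Rightarrow> ('v set \<times> nat \<Rightarrow> bit) pmodule" where
  "rel_module K Ks i = free_on (rel_basis K Ks i) (rel_grade Ks)"

definition p1_map ::
  "'v set set \<Rightarrow> (grade \<Rightarrow> 'v set set) \<Rightarrow> int
    \<Rightarrow> ('v set \<times> nat \<Rightarrow> bit) \<Rightarrow> ('v set \<times> nat \<Rightarrow> bit)" where
  "p1_map K Ks i =
     linear_extension (rel_basis K Ks i) (\<lambda>(\<sigma>, j). unit_vec (\<sigma>, j) + unit_vec (\<sigma>, j + 1))"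

definition connecting_path :: "'v set \<Rightarrow> nat \<Rightarrow> nat \<Rightarrow> 'v set \<times> nat \<Rightarrow> bit" where
  "connecting_path \<tau> j l = (\<Sum>k\<in>{min j l..<max j l}. unit_vec (\<tau>, k))"

(* z \<sigma> j \<tau> is the position in gen_grades Ks \<tau> of the grade chosen for the facet \<tau> of \<sigma> and
   the generator (\<sigma>, j). *)
definition facet_choice ::
  "'v set set \<Rightarrow> (grade \<Rightarrow> 'v set set) \<Rightarrow> ('v set \<Rightarrow> nat \<Rightarrow> 'v set \<Rightarrow> nat) \<Rightarrow> bool" where
  "facet_choice K Ks z \<longleftrightarrow>
     (\<forall>\<sigma>\<in>K. \<forall>j < length (gen_grades Ks \<sigma>). \<forall>\<tau>\<in>facets \<sigma>.
        z \<sigma> j \<tau> < length (gen_grades Ks \<tau>) \<and>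
        gen_grades Ks \<tau> ! z \<sigma> j \<tau> \<le> gen_grades Ks \<sigma> ! j)"

definition f0_map ::
  "'v set set \<Rightarrow> (grade \<Rightarrow> 'v set set) \<Rightarrow> ('v set \<Rightarrow> nat \<Rightarrow> 'v set \<Rightarrow> nat) \<Rightarrow> int
    \<Rightarrow> ('v set \<times> nat \<Rightarrow> bit) \<Rightarrow> ('v set \<times> nat \<Rightarrow> bit)" where
  "f0_map K Ks z i =
     linear_extension (gen_basis K Ks i) (\<lambda>(\<sigma>, j). \<Sum>\<tau>\<in>facets \<sigma>. unit_vec (\<tau>, z \<sigma> j \<tau>))"

definition f1_map ::
  "'v set set \<Rightarrow> (grade \<Rightarrow> 'v set set) \<Rightarrow> ('v set \<Rightarrow> nat \<Rightarrow> 'v set \<Rightarrow> nat) \<Rightarrow> int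
    \<Rightarrow> ('v set \<times> nat \<Rightarrow> bit) \<Rightarrow> ('v set \<times> nat \<Rightarrow> bit)" where
  "f1_map K Ks z i =
     linear_extension (rel_basis K Ks i)
       (\<lambda>(\<sigma>, j). \<Sum>\<tau>\<in>facets \<sigma>. connecting_path \<tau> (z \<sigma> j \<tau>) (z \<sigma> (j + 1) \<tau>))"

(* A codimension-2 face \<tau> lies in exactly two facets \<rho> of \<sigma>, and each contributes the
   generator of \<tau> at position z \<rho> (z \<sigma> j \<rho>) \<tau>.  These positions form a set with at most two
   elements, so its minimum and maximum are the two (possibly equal) endpoints. *)
definition contributions ::
  "('v set \<Rightarrow> nat \<Rightarrow> 'v set \<Rightarrow> nat) \<Rightarrow> 'v set \<Rightarrow> nat \<Rightarrow> 'v set \<Rightarrow> nat set" where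
  "contributions z \<sigma> j \<tau> = {z \<rho> (z \<sigma> j \<rho>) \<tau> |\<rho>. \<rho> \<in> facets \<sigma> \<and> \<tau> \<in> facets \<rho>}"

definition h0_map ::
  "'v set set \<Rightarrow> (grade \<Rightarrow> 'v set set) \<Rightarrow> ('v set \<Rightarrow> nat \<Rightarrow> 'v set \<Rightarrow> nat) \<Rightarrow> int
    \<Rightarrow> ('v set \<times> nat \<Rightarrow> bit) \<Rightarrow> ('v set \<times> nat \<Rightarrow> bit)" where
  "h0_map K Ks z i =
     linear_extension (gen_basis K Ks i)
       (\<lambda>(\<sigma>, j). \<Sum>\<tau>\<in>codim2_faces \<sigma>.
          connecting_path \<tau> (Min (contributions z \<sigma> j \<tau>)) (Max (contributions z \<sigma> j \<tau>)))"

(* In degrees below 0 all modules vanish, and so does the relation summand in degree 0. *)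
definition path_complex ::
  "'v set set \<Rightarrow> (grade \<Rightarrow> 'v set set) \<Rightarrow> ('v set \<Rightarrow> nat \<Rightarrow> 'v set \<Rightarrow> nat)
    \<Rightarrow> (('v set \<times> nat \<Rightarrow> bit) \<times> ('v set \<times> nat \<Rightarrow> bit)) pcomplex" where
  "path_complex K Ks z = \<lparr>
     cmod = (\<lambda>i. direct_sum2 (gen_module K Ks i) (rel_module K Ks (i - 1))),
     cdiff = (\<lambda>i s (g, r).
        (f0_map K Ks z i g + p1_map K Ks (i - 1) r,
         h0_map K Ks z i g + f1_map K Ks z (i - 1) r))\<rparr>"

end

theory Submission
  imports Defs "HOL-Library.Product_Plus"
begin

text \<open>All structure maps are inclusions of spaces of finitely supported functions, so everything
  can be checked grade by grade. At a grade the active generators of a simplex form an interval of the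
  path (first coordinates increase, second coordinates decrease along it), and the active relations are
  exactly the edges of that interval. Hence \<open>0 \<rightarrow> R \<rightarrow> G \<rightarrow> C \<rightarrow> 0\<close>, with maps \<open>p1\<close> and the augmentation
  \<open>\<epsilon>\<close> sending each generator to its simplex, is exact. Besides \<open>\<epsilon> f0 = bd \<epsilon>\<close>, the identities
  \<open>f0 p1 = p1 f1\<close> and \<open>f0 f0 = p1 h0\<close> hold because \<open>p1\<close> maps a path to the sum of its endpoints; the
  remaining two, \<open>h0 p1 = f1 f1\<close> and \<open>h0 f0 = f1 h0\<close>, follow since \<open>p1\<close> is injective. The map
  \<open>(g, r) \<mapsto> \<epsilon> g\<close> is then a quasi-isomorphism by a diagram chase.\<close>

declare split_paired_All [simp del] split_paired_Ex [simp del]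

section \<open>Persistence modules whose structure maps are inclusions\<close>

text \<open>In a group where \<open>x + x = 0\<close> this says being a subspace over the
  two-element field: the only scalars are 0 and 1, and negation is the identity.\<close>

definition add_closed :: "'a::monoid_add set \<Rightarrow> bool" where
  "add_closed B \<longleftrightarrow> 0 \<in> B \<and> (\<forall>x\<in>B. \<forall>y\<in>B. x + y \<in> B)"

text \<open>All grade spaces are subspaces of one ambient vector space, given by the whole type.
  Operations and structure maps are thereby fixed, and only the increasing family of carriers
  carries information.\<close>

definition inclusion_module :: "'a::ab_group_add pmodule \<Rightarrow> bool" where
  "inclusion_module M \<longleftrightarrow>
     (\<forall>x::'a. x + x = 0) \<and>
     (\<forall>s. add_closed (carrier (obj M s))) \<and>
     (\<forall>s. zero (obj M s) = 0) \<and>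
     (\<forall>s. add (obj M s) = (+)) \<and>
     (\<forall>s a x. a \<odot>\<^bsub>obj M s\<^esub> x = (if a = 0 then 0 else x)) \<and>
     (\<forall>s t. s \<le> t \<longrightarrow> carrier (obj M s) \<subseteq> carrier (obj M t)) \<and>
     (\<forall>s t x. str M s t x = x)"

lemma inclusion_moduleD:
  fixes M :: "'a::ab_group_add pmodule"
  assumes "inclusion_module M"
  shows "\<And>x::'a. x + x = 0"
    and "add_closed (carrier (obj M s))"
    and "zero (obj M s) = 0"
    and "add (obj M s) = (+)"
    and "\<And>a x. a \<odot>\<^bsub>obj M s\<^esub> x = (if a = 0 then 0 else x)"
    and "\<And>x. s \<le> t \<Longrightarrow> x \<in> carrier (obj M s) \<Longrightarrow> x \<in> carrier (obj M t)"
    and "\<And>x. str M s t x = x"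
  using assms unfolding inclusion_module_def by blast+

text \<open>Additivity forces \<open>h 0 = 0\<close>, and 0 and 1 are the only scalars, so
  homogeneity comes for free.\<close>

lemma linear_maps_inclusion:
  fixes M :: "'a::ab_group_add pmodule" and N :: "'b::ab_group_add pmodule"
  assumes M: "inclusion_module M" and N: "inclusion_module N"
  shows "h \<in> linear_maps (obj M s) (obj N t) \<longleftrightarrow>
    (\<forall>x\<in>carrier (obj M s). h x \<in> carrier (obj N t)) \<and>
    (\<forall>x\<in>carrier (obj M s). \<forall>y\<in>carrier (obj M s). h (x + y) = h x + h y)"
proof -
  have "h 0 = 0"
    if "\<forall>x\<in>carrier (obj M s). \<forall>y\<in>carrier (obj M s). h (x + y) = h x + h y"
    using that inclusion_moduleD(2)[OF M, of s] unfolding add_closed_def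
    by (metis add_0 add_cancel_right_left)
  moreover have "0 \<in> carrier (obj M s)"
    using inclusion_moduleD(2)[OF M, of s] unfolding add_closed_def by blast
  ultimately show ?thesis
    unfolding linear_maps_def
    by (auto simp: inclusion_moduleD(3-5)[OF M] inclusion_moduleD(3-5)[OF N])
qed

text \<open>With inclusions as structure maps, naturality means that the map at the larger grade
  restricts to the map at the smaller one.\<close>

lemma pmorphism_inclusion:
  fixes M :: "'a::ab_group_add pmodule" and N :: "'b::ab_group_add pmodule"
  assumes "inclusion_module M" and "inclusion_module N"
  shows "pmorphism M N \<phi> \<longleftrightarrow>
    (\<forall>s. \<forall>x\<in>carrier (obj M s). \<phi> s x \<in> carrier (obj N s)) \<and>
    (\<forall>s. \<forall>x\<in>carrier (obj M s). \<forall>y\<in>carrier (obj M s). \<phi> s (x + y) = \<phi> s x + \<phi> s y) \<and>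
    (\<forall>s t. s \<le> t \<longrightarrow> (\<forall>x\<in>carrier (obj M s). \<phi> t x = \<phi> s x))"
  unfolding pmorphism_def linear_maps_inclusion[OF assms]
  by (auto simp: inclusion_moduleD(7)[OF assms(1)] inclusion_moduleD(7)[OF assms(2)])

lemma module_inclusion:
  fixes M :: "'a::ab_group_add pmodule"
  assumes M: "inclusion_module M"
  shows "Module.module Z2 (obj M s)"
proof (rule moduleI)
  note D = inclusion_moduleD[OF M]
  have c: "0 \<in> carrier (obj M s)"
    "\<And>x y. x \<in> carrier (obj M s) \<Longrightarrow> y \<in> carrier (obj M s) \<Longrightarrow> x + y \<in> carrier (obj M s)"
    using D(2) unfolding add_closed_def by blast+
  show "cring Z2" by (rule cring_from_type_algebra)
  show "abelian_group (obj M s)"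
    by (rule abelian_groupI) (auto simp: D(3,4) c algebra_simps intro: D(1))
  have bit: "a = 0 \<or> a = 1" for a :: bit by (cases a) auto
  fix a b :: bit and x y
  assume x: "x \<in> carrier (obj M s)"
  show "a \<odot>\<^bsub>obj M s\<^esub> x \<in> carrier (obj M s)"
    by (simp add: D(5) c x)
  show "(a \<oplus>\<^bsub>Z2\<^esub> b) \<odot>\<^bsub>obj M s\<^esub> x = (a \<odot>\<^bsub>obj M s\<^esub> x) \<oplus>\<^bsub>obj M s\<^esub> (b \<odot>\<^bsub>obj M s\<^esub> x)"
    using bit[of a] bit[of b] by (auto simp: D ring_of_type_algebra_def)
  show "(a \<otimes>\<^bsub>Z2\<^esub> b) \<odot>\<^bsub>obj M s\<^esub> x = a \<odot>\<^bsub>obj M s\<^esub> (b \<odot>\<^bsub>obj M s\<^esub> x)"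
    using bit[of a] bit[of b] by (auto simp: D ring_of_type_algebra_def)
  show "\<one>\<^bsub>Z2\<^esub> \<odot>\<^bsub>obj M s\<^esub> x = x"
    by (simp add: D ring_of_type_algebra_def)
  show "a \<odot>\<^bsub>obj M s\<^esub> (x \<oplus>\<^bsub>obj M s\<^esub> y) = (a \<odot>\<^bsub>obj M s\<^esub> x) \<oplus>\<^bsub>obj M s\<^esub> (a \<odot>\<^bsub>obj M s\<^esub> y)"
    by (simp add: D)
qed

lemma bipersistence_module_inclusion:
  fixes M :: "'a::ab_group_add pmodule"
  assumes M: "inclusion_module M"
  shows "bipersistence_module M"
  unfolding bipersistence_module_def linear_maps_inclusion[OF M M]
  by (auto simp: inclusion_moduleD(7)[OF M] module_inclusion[OF M] inclusion_moduleD(6)[OF M])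

lemma carrier_direct_sum_upset:
  "carrier (obj (direct_sum I (\<lambda>i. upset_module (A i))) s) =
    {v. (\<forall>i. v i \<noteq> 0 \<longrightarrow> i \<in> I \<and> (\<exists>a\<in>A i. a \<le> s)) \<and> finite {i. v i \<noteq> 0}}"
  unfolding direct_sum_def upset_module_def by (auto split: if_splits)

lemma inclusion_direct_sum_upset:
  "inclusion_module (direct_sum I (\<lambda>i. upset_module (A i)))"
proof -
  have self: "a + a = 0" for a :: bit by (cases a) auto
  have smult: "(\<lambda>i. a * v i) = (if a = 0 then 0 else v)" for a and v :: "'a \<Rightarrow> bit"
    by (cases a) auto
  have fin: "finite {i. v i + w i \<noteq> 0}" if "finite {i. v i \<noteq> 0}" "finite {i. w i \<noteq> 0}"
    for v w :: "'a \<Rightarrow> bit"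
    by (rule finite_subset[of _ "{i. v i \<noteq> 0} \<union> {i. w i \<noteq> 0}"]) (use that in auto)
  let ?M = "direct_sum I (\<lambda>i. upset_module (A i))"
  have "add_closed (carrier (obj ?M s))" for s
    unfolding carrier_direct_sum_upset add_closed_def using fin by (auto simp del: add_bit_eq_xor bit_not_zero_iff) force+
  moreover have "carrier (obj ?M s) \<subseteq> carrier (obj ?M t)" if "s \<le> t" for s t
    unfolding carrier_direct_sum_upset using that by (blast intro: order_trans)
  ultimately show ?thesis
    unfolding inclusion_module_def
    by (simp add: direct_sum_def upset_module_def smult fun_eq_iff self
        del: add_bit_eq_xor mult_bit_eq_and)
qed

text \<open>For a finite index set the finiteness clause of a direct sum is automatic, so grade
  spaces are described by supports alone.\<close>

definition vecs :: "'b set \<Rightarrow> ('b \<Rightarrow> bit) set" where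
  "vecs S = {v. \<forall>b. v b \<noteq> 0 \<longrightarrow> b \<in> S}"

lemma carrier_direct_sum_upset_finite:
  assumes "finite I"
  shows "carrier (obj (direct_sum I (\<lambda>i. upset_module (A i))) s) =
    vecs {i \<in> I. \<exists>a\<in>A i. a \<le> s}"
  unfolding carrier_direct_sum_upset vecs_def
  by (auto intro: finite_subset[OF _ assms])

lemma inclusion_direct_sum2:
  fixes M :: "'a::ab_group_add pmodule" and N :: "'b::ab_group_add pmodule"
  assumes M: "inclusion_module M" and N: "inclusion_module N"
  shows "inclusion_module (direct_sum2 M N)"
proof -
  note DM = inclusion_moduleD[OF M] and DN = inclusion_moduleD[OF N]
  have "add_closed (carrier (obj M s) \<times> carrier (obj N s))" for s
    using DM(2)[of s] DN(2)[of s] unfolding add_closed_def by (auto simp: zero_prod_def)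
  moreover have "carrier (obj M s) \<times> carrier (obj N s) \<subseteq> carrier (obj M t) \<times> carrier (obj N t)"
    if "s \<le> t" for s t
    using DM(6)[OF that] DN(6)[OF that] by blast
  ultimately show ?thesis
    unfolding inclusion_module_def direct_sum2_def
    by (simp add: DM(1,3-5,7) DN(1,3-5,7) zero_prod_def fun_eq_iff split_paired_All)
qed

section \<open>Homology of complexes of inclusion modules\<close>

definition coset :: "'a::plus set \<Rightarrow> 'a \<Rightarrow> 'a set" where
  "coset B x = (\<lambda>b. b + x) ` B"

text \<open>In characteristic 2 the sum of two representatives is their difference.\<close>

lemma coset_eq_iff:
  fixes B :: "'a::ab_group_add set"
  assumes B: "add_closed B" and char2: "\<And>x::'a. x + x = 0"
  shows "coset B x = coset B y \<longleftrightarrow> x + y \<in> B"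
proof
  assume "coset B x = coset B y"
  moreover have "x \<in> coset B x"
    using B unfolding add_closed_def coset_def by force
  ultimately obtain b where "b \<in> B" "x = b + y" unfolding coset_def by auto
  then show "x + y \<in> B" by (simp add: add.assoc char2)
next
  assume xy: "x + y \<in> B"
  have *: "coset B u \<subseteq> coset B v" if "u + v \<in> B" for u v
  proof
    fix w assume "w \<in> coset B u"
    then obtain b where b: "b \<in> B" "w = b + u" unfolding coset_def by auto
    have "w = (b + (u + v)) + v" using b(2) by (simp add: add.assoc char2)
    then show "w \<in> coset B v"
      using B b(1) that unfolding coset_def add_closed_def by blast
  qed
  show "coset B x = coset B y"
    using *[of x y] *[of y x] xy by (simp add: add.commute)
qed

text \<open>This is well-definedness on quotients. Maps and scalar multiplication on homology are
  defined as unions over all representatives; such a union collapses to one coset if changing the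
  representative by \<open>B\<close> changes the value by \<open>B'\<close>.\<close>

lemma Union_coset:
  fixes B' :: "'b::ab_group_add set"
  assumes B: "add_closed B" and B': "add_closed B'" and char2: "\<And>x::'b. x + x = 0"
    and f: "\<And>b. b \<in> B \<Longrightarrow> f (b + x) + f x \<in> B'"
  shows "(\<Union>y\<in>coset B x. coset B' (f y)) = coset B' (f x)"
proof -
  have "coset B' (f y) = coset B' (f x)" if "y \<in> coset B x" for y
    using that f unfolding coset_eq_iff[OF B' char2] by (auto simp: coset_def)
  moreover have "coset B x \<noteq> {}" using B unfolding coset_def add_closed_def by blast
  ultimately show ?thesis by auto
qed

text \<open>The left-hand side is the unfolded form of \<open><+>\<close>, the addition in
  \<open>quotient_module\<close>.\<close>

lemma set_add_coset:
  fixes B :: "'a::ab_group_add set"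
  assumes B: "add_closed B"
  shows "(\<Union>h\<in>coset B x. \<Union>k\<in>coset B y. {h + k}) = coset B (x + y)"
proof
  show "(\<Union>h\<in>coset B x. \<Union>k\<in>coset B y. {h + k}) \<subseteq> coset B (x + y)"
  proof
    fix w assume "w \<in> (\<Union>h\<in>coset B x. \<Union>k\<in>coset B y. {h + k})"
    then obtain b c where "b \<in> B" "c \<in> B" "w = (b + x) + (c + y)"
      unfolding coset_def by auto
    then have "w = (b + c) + (x + y)" "b + c \<in> B"
      using B by (auto simp: add_closed_def algebra_simps)
    then show "w \<in> coset B (x + y)" unfolding coset_def by blast
  qed
  show "coset B (x + y) \<subseteq> (\<Union>h\<in>coset B x. \<Union>k\<in>coset B y. {h + k})"
  proof
    fix w assume "w \<in> coset B (x + y)"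
    then obtain b where "b \<in> B" "w = (b + x) + (0 + y)"
      unfolding coset_def by (auto simp: algebra_simps)
    then show "w \<in> (\<Union>h\<in>coset B x. \<Union>k\<in>coset B y. {h + k})"
      using B unfolding coset_def add_closed_def by blast
  qed
qed

section \<open>Homology classes computed on representatives\<close>

locale inclusion_complex =
  fixes C :: "'a::ab_group_add pcomplex"
  assumes inclusion: "inclusion_module (cmod C i)"
    and complex: "chain_complex C"
begin

lemmas D = inclusion_moduleD[OF inclusion]

lemma diff_closed: "x \<in> carrier (obj (cmod C i) s) \<Longrightarrow> cdiff C i s x \<in> carrier (obj (cmod C (i - 1)) s)"
  and diff_add: "x \<in> carrier (obj (cmod C i) s) \<Longrightarrow> y \<in> carrier (obj (cmod C i) s) \<Longrightarrow>
      cdiff C i s (x + y) = cdiff C i s x + cdiff C i s y"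
  and diff_natural: "s \<le> t \<Longrightarrow> x \<in> carrier (obj (cmod C i) s) \<Longrightarrow> cdiff C i t x = cdiff C i s x"
  using complex unfolding chain_complex_def pmorphism_inclusion[OF inclusion inclusion]
  by blast+

lemma diff_zero: "cdiff C i s 0 = 0"
proof -
  have "0 \<in> carrier (obj (cmod C i) s)" using D(2) unfolding add_closed_def by blast
  from diff_add[OF this this] show ?thesis by simp
qed

lemma mem_cycles: "x \<in> cycles C i s \<longleftrightarrow> x \<in> carrier (obj (cmod C i) s) \<and> cdiff C i s x = 0"
  unfolding cycles_def a_kernel_def kernel_def by (simp add: D(3))

lemma add_closed_cycles: "add_closed (cycles C i s)"
  using D(2)[of i s] unfolding add_closed_def by (auto simp: mem_cycles diff_zero diff_add)

lemma boundaries_subset: "boundaries C i s \<subseteq> carrier (obj (cmod C i) s)"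
  unfolding boundaries_def using diff_closed[of _ "i + 1" s] by auto

lemma add_closed_boundaries: "add_closed (boundaries C i s)"
proof -
  have "0 \<in> boundaries C i s"
    using D(2)[of "i + 1" s] diff_zero[of "i + 1" s]
    unfolding boundaries_def add_closed_def by force
  moreover have "x + y \<in> boundaries C i s"
    if "x \<in> boundaries C i s" "y \<in> boundaries C i s" for x y
    using that D(2)[of "i + 1" s] unfolding boundaries_def add_closed_def
    by (auto simp flip: diff_add)
  ultimately show ?thesis unfolding add_closed_def by blast
qed

lemma boundaries_mono:
  assumes "s \<le> t"
  shows "boundaries C i s \<subseteq> boundaries C i t"
  unfolding boundaries_def using D(6)[OF assms] diff_natural[OF assms] by (metis image_subsetI imageI)

text \<open>Only the ambient addition enters, so cosets forget the grade and, in the next lemma,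
  also the restriction of the carrier to cycles.\<close>

lemma r_coset: "B +>\<^bsub>obj (cmod C i) s\<^esub> x = coset B x"
  unfolding a_r_coset_def' coset_def by (auto simp: D(4))

lemma r_coset': "B +>\<^bsub>obj (cmod C i) s\<lparr>carrier := Z\<rparr>\<^esub> x = coset B x"
  unfolding a_r_coset_def' coset_def by (auto simp: D(4))

lemma carrier_homology:
  "carrier (obj (homology C i) s) = coset (boundaries C i s) ` cycles C i s"
  unfolding homology_def quotient_module_def A_RCOSETS_def'
  by (auto simp: a_r_coset_def' coset_def D(4))

lemma add_homology:
  "coset (boundaries C i s) x \<oplus>\<^bsub>obj (homology C i) s\<^esub> coset (boundaries C i s) y
    = coset (boundaries C i s) (x + y)"
  unfolding homology_def quotient_module_def set_add_coset[OF add_closed_boundaries, symmetric]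
  by (simp add: set_add_def' D(4))

lemma smult_homology:
  "a \<odot>\<^bsub>obj (homology C i) s\<^esub> coset (boundaries C i s) x
    = coset (boundaries C i s) (if a = 0 then 0 else x)"
proof -
  have "(\<Union>y\<in>coset (boundaries C i s) x. coset (boundaries C i s) (if a = 0 then 0 else y))
      = coset (boundaries C i s) (if a = 0 then 0 else x)"
    by (rule Union_coset[OF add_closed_boundaries add_closed_boundaries D(1)])
      (use add_closed_boundaries in \<open>auto simp: add.assoc D(1) add_closed_def\<close>)
  then show ?thesis
    unfolding homology_def quotient_module_def by (simp add: r_coset' D(5))
qed

lemma str_homology:
  assumes "s \<le> t"
  shows "str (homology C i) s t (coset (boundaries C i s) x) = coset (boundaries C i t) x"
proof -
  have "(\<Union>y\<in>coset (boundaries C i s) x. coset (boundaries C i t) y) = coset (boundaries C i t) x"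
    by (rule Union_coset[OF add_closed_boundaries add_closed_boundaries D(1)])
      (use boundaries_mono[OF assms, of i] in \<open>auto simp: add.assoc D(1)\<close>)
  then show ?thesis unfolding homology_def by (simp add: r_coset D(7))
qed

end

text \<open>Cycles are required to lift exactly, not just up to a boundary; the augmentation has
  this stronger property, which makes surjectivity on homology immediate.\<close>

lemma homology_isomorphismI:
  fixes C :: "'a::ab_group_add pcomplex" and D :: "'b::ab_group_add pcomplex"
  assumes C: "\<And>i. inclusion_module (cmod C i)" and D: "\<And>i. inclusion_module (cmod D i)"
    and \<phi>: "chain_map C D \<phi>"
    and surj: "\<And>s y. y \<in> cycles D i s \<Longrightarrow> \<exists>x\<in>cycles C i s. \<phi> i s x = y"
    and inj: "\<And>s x. x \<in> cycles C i s \<Longrightarrow> \<phi> i s x \<in> boundaries D i s \<Longrightarrow> x \<in> boundaries C i s"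
  shows "pisomorphism (homology C i) (homology D i) (homology_map D \<phi> i)"
proof -
  interpret C: inclusion_complex C
    by unfold_locales (use C \<phi> in \<open>auto simp: chain_map_def\<close>)
  interpret D: inclusion_complex D
    by unfold_locales (use D \<phi> in \<open>auto simp: chain_map_def\<close>)
  have closed: "\<phi> j s x \<in> carrier (obj (cmod D j) s)"
    and add: "y \<in> carrier (obj (cmod C j) s) \<Longrightarrow> \<phi> j s (x + y) = \<phi> j s x + \<phi> j s y"
    and natural: "s \<le> t \<Longrightarrow> \<phi> j t x = \<phi> j s x"
    and comm: "\<phi> (j - 1) s (cdiff C j s x) = cdiff D j s (\<phi> j s x)"
    if "x \<in> carrier (obj (cmod C j) s)" for j s t x y
    using \<phi> that unfolding chain_map_def pmorphism_inclusion[OF C D] by (blast, blast, blast, metis)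
  have zero: "\<phi> j s 0 = 0" for j s
    using add[of 0 j s 0] C.D(2)[of j s] by (simp add: add_closed_def)
  have cyc: "\<phi> i s x \<in> cycles D i s" if "x \<in> cycles C i s" for s x
    using that comm[of x i s] closed[of x i s] by (auto simp: C.mem_cycles D.mem_cycles zero)
  have bd: "\<phi> i s x \<in> boundaries D i s" if x: "x \<in> boundaries C i s" for s x
  proof -
    obtain y where y: "y \<in> carrier (obj (cmod C (i + 1)) s)" "x = cdiff C (i + 1) s y"
      using x unfolding boundaries_def by auto
    show ?thesis
      using comm[OF y(1)] closed[OF y(1)] unfolding boundaries_def y(2) by auto
  qed
  \<comment> \<open>The value is independent of the representative since chain maps send boundaries
    to boundaries; everything after this computes with representatives.\<close>
  have hom: "homology_map D \<phi> i s (coset (boundaries C i s) x) = coset (boundaries D i s) (\<phi> i s x)"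
    if x: "x \<in> cycles C i s" for s x
  proof -
    have "(\<Union>y\<in>coset (boundaries C i s) x. coset (boundaries D i s) (\<phi> i s y))
        = coset (boundaries D i s) (\<phi> i s x)"
    proof (rule Union_coset[OF C.add_closed_boundaries D.add_closed_boundaries D.D(1)])
      fix b assume b: "b \<in> boundaries C i s"
      then have "\<phi> i s (b + x) = \<phi> i s b + \<phi> i s x"
        using add[of b i s x] x C.boundaries_subset[of i s] by (auto simp: C.mem_cycles)
      then show "\<phi> i s (b + x) + \<phi> i s x \<in> boundaries D i s"
        using bd[OF b] by (simp add: add.assoc D.D(1))
    qed
    then show ?thesis unfolding homology_map_def by (simp add: D.r_coset)
  qed
  have cyc_add: "x + y \<in> cycles C i s" "\<phi> i s (x + y) = \<phi> i s x + \<phi> i s y"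
    if "x \<in> cycles C i s" "y \<in> cycles C i s" for x y s
    using that C.add_closed_cycles[of i s] add[of x i s y]
    by (simp_all add: add_closed_def C.mem_cycles)
  have cyc_zero: "0 \<in> cycles C i s" for s
    using C.add_closed_cycles[of i s] by (simp add: add_closed_def)
  have lin: "homology_map D \<phi> i s \<in> linear_maps (obj (homology C i) s) (obj (homology D i) s)" for s
    unfolding linear_maps_def C.carrier_homology D.carrier_homology
    by (auto simp: C.add_homology D.add_homology C.smult_homology D.smult_homology
        hom cyc cyc_add cyc_zero zero)
  have nat: "homology_map D \<phi> i t (str (homology C i) s t S) = str (homology D i) s t (homology_map D \<phi> i s S)"
    if st: "s \<le> t" and S: "S \<in> carrier (obj (homology C i) s)" for s t S
  proof -
    obtain x where x: "x \<in> cycles C i s" "S = coset (boundaries C i s) x"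
      using S unfolding C.carrier_homology by auto
    have "x \<in> cycles C i t"
      using x(1) C.D(6)[OF st] C.diff_natural[OF st] by (auto simp: C.mem_cycles)
    then show ?thesis
      using x natural[OF _ st, of x i]
      by (simp add: C.str_homology[OF st] D.str_homology[OF st] hom C.mem_cycles)
  qed
  have bij: "bij_betw (homology_map D \<phi> i s) (carrier (obj (homology C i) s)) (carrier (obj (homology D i) s))" for s
  proof (rule bij_betw_imageI)
    show "inj_on (homology_map D \<phi> i s) (carrier (obj (homology C i) s))"
    proof (rule inj_onI)
      fix S T
      assume "S \<in> carrier (obj (homology C i) s)" "T \<in> carrier (obj (homology C i) s)"
        and eq: "homology_map D \<phi> i s S = homology_map D \<phi> i s T"
      then obtain x y where x: "x \<in> cycles C i s" "S = coset (boundaries C i s) x"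
        and y: "y \<in> cycles C i s" "T = coset (boundaries C i s) y"
        unfolding C.carrier_homology by auto
      \<comment> \<open>Equality of the image classes becomes a statement about the single cycle
        \<open>x + y\<close>, to which \<open>inj\<close> applies.\<close>
      have "\<phi> i s x + \<phi> i s y \<in> boundaries D i s"
        using eq x y by (simp add: hom coset_eq_iff[OF D.add_closed_boundaries D.D(1)])
      then have "x + y \<in> boundaries C i s"
        using inj[of "x + y" s] cyc_add[OF x(1) y(1)] by simp
      then show "S = T"
        using x y by (simp add: coset_eq_iff[OF C.add_closed_boundaries C.D(1)])
    qed
    show "homology_map D \<phi> i s ` carrier (obj (homology C i) s) = carrier (obj (homology D i) s)"
    proof -
      have "homology_map D \<phi> i s ` carrier (obj (homology C i) s) =
          coset (boundaries D i s) ` \<phi> i s ` cycles C i s"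
        unfolding C.carrier_homology image_image by (rule image_cong) (auto simp: hom)
      also have "\<phi> i s ` cycles C i s = cycles D i s"
        using cyc surj by fast
      finally show ?thesis unfolding D.carrier_homology .
    qed
  qed
  show ?thesis
    unfolding pisomorphism_def pmorphism_def using lin nat bij by blast
qed

declare add_bit_eq_xor [simp del] mult_bit_eq_and [simp del]

section \<open>Vectors over \<open>\<int>\<^sub>2\<close> with prescribed support\<close>

lemma bit_add_self [simp]: "a + a = (0 :: bit)"
  by (cases a) auto

lemma vec_add_self [simp]: "v + v = (0 :: 'b \<Rightarrow> bit)"
  by (simp add: fun_eq_iff)

lemma vec_add_cancel [simp]: "v + (v + w) = (w :: 'b \<Rightarrow> bit)"
  by (simp flip: add.assoc)

lemma vec_add_eq_0_iff: "v + w = 0 \<longleftrightarrow> v = (w :: 'b \<Rightarrow> bit)"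
proof
  assume "v + w = 0"
  then have "v + (v + w) = v" by simp
  then show "v = w" by simp
qed simp

lemma vecs_mono: "S \<subseteq> T \<Longrightarrow> v \<in> vecs S \<Longrightarrow> v \<in> vecs T"
  unfolding vecs_def by blast

lemma vecs_zero [simp]: "0 \<in> vecs S"
  unfolding vecs_def by simp

lemma vecs_add: "v \<in> vecs S \<Longrightarrow> w \<in> vecs S \<Longrightarrow> v + w \<in> vecs S"
  unfolding vecs_def by (simp del: bit_not_zero_iff) (metis add_0)

lemma vecs_sum: "(\<And>i. i \<in> I \<Longrightarrow> f i \<in> vecs S) \<Longrightarrow> sum f I \<in> vecs S"
  by (induction I rule: infinite_finite_induct) (auto intro: vecs_add)

lemma vecs_unit_vec: "unit_vec b \<in> vecs S \<longleftrightarrow> b \<in> S"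
  unfolding vecs_def unit_vec_def by auto

text \<open>Every nonzero coefficient is 1, so a vector is the plain sum of the unit vectors over
  its support.\<close>

lemma vecs_expand:
  assumes "finite S" and "v \<in> vecs S"
  shows "v = (\<Sum>b\<in>{b\<in>S. v b \<noteq> 0}. unit_vec b)"
proof
  fix c
  have sumf: "(\<Sum>b\<in>A. unit_vec b) c = (\<Sum>b\<in>A. unit_vec b c)" for A :: "'a set"
    by (induction A rule: infinite_finite_induct) auto
  have "(\<Sum>b\<in>{b\<in>S. v b \<noteq> 0}. unit_vec b) c = (\<Sum>b\<in>{b\<in>S. v b \<noteq> 0}. if c = b then 1 else 0)"
    unfolding sumf by (auto intro: sum.cong simp: unit_vec_def)
  also have "\<dots> = v c"
    using assms unfolding vecs_def by (cases "v c") (auto simp: sum.delta')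
  finally show "v c = (\<Sum>b\<in>{b\<in>S. v b \<noteq> 0}. unit_vec b) c" by simp
qed

text \<open>By \<open>vecs_expand\<close> no scalars occur in the expansion, so additivity alone
  reduces an identity of maps to basis vectors. Most identities between the maps below are proved
  this way.\<close>

lemma additive_eqI:
  fixes g h :: "('b \<Rightarrow> bit) \<Rightarrow> 'c::ab_group_add"
  assumes g: "Modules.additive g" and h: "Modules.additive h" and S: "finite S"
    and eq: "\<And>b. b \<in> S \<Longrightarrow> g (unit_vec b) = h (unit_vec b)" and v: "v \<in> vecs S"
  shows "g v = h v"
proof -
  interpret g: Modules.additive g by fact
  interpret h: Modules.additive h by fact
  have "g (\<Sum>b\<in>{b\<in>S. v b \<noteq> 0}. unit_vec b) = h (\<Sum>b\<in>{b\<in>S. v b \<noteq> 0}. unit_vec b)"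
    unfolding g.sum h.sum by (rule sum.cong) (auto intro: eq)
  then show ?thesis using vecs_expand[OF S v] by simp
qed

section \<open>Linear extensions of maps given on a basis\<close>

lemma additive_comp:
  assumes "Modules.additive g" and "Modules.additive h"
  shows "Modules.additive (\<lambda>x. g (h x))"
  using assms unfolding Modules.additive_def by simp

lemma additive_linear_extension: "Modules.additive (linear_extension B f)"
  unfolding Modules.additive_def linear_extension_def
  by (auto simp: fun_eq_iff algebra_simps sum.distrib)

lemma linear_extension_unit_vec:
  assumes "finite B" and "b \<in> B"
  shows "linear_extension B f (unit_vec b) = f b"
proof
  fix c
  have "linear_extension B f (unit_vec b) c = (\<Sum>b'\<in>B. if b' = b then f b' c else 0)"
    unfolding linear_extension_def unit_vec_def by (auto intro: sum.cong)
  then show "linear_extension B f (unit_vec b) c = f b c"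
    using assms by simp
qed

text \<open>A nonzero coefficient of the image comes from some basis element in the support of
  \<open>v\<close>. With the elements active at a grade for \<open>S\<close> and \<open>T\<close>,
  this shows that a map respects grades.\<close>

lemma linear_extension_vecs:
  assumes v: "v \<in> vecs S" and f: "\<And>b. b \<in> B \<Longrightarrow> b \<in> S \<Longrightarrow> f b \<in> vecs T"
  shows "linear_extension B f v \<in> vecs T"
  unfolding vecs_def
proof safe
  fix c assume "linear_extension B f v c \<noteq> 0"
  then obtain b where b: "b \<in> B" "v b * f b c \<noteq> 0"
    unfolding linear_extension_def by (rule sum.not_neutral_contains_not_neutral)
  then have "b \<in> S" "f b c \<noteq> 0" using v by (auto simp: vecs_def)
  with f[of b] b(1) show "c \<in> T" by (auto simp: vecs_def)
qed

text \<open>Each inner term occurs twice and cancels.\<close>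

lemma sum_telescope_char2:
  fixes f :: "nat \<Rightarrow> 'b \<Rightarrow> bit"
  assumes "m \<le> n"
  shows "(\<Sum>k\<in>{m..<n}. f k + f (Suc k)) = f m + f n"
  using assms by (induction n rule: dec_induct) (auto simp: add.assoc)

section \<open>Minimal grades\<close>

text \<open>Passing to a different grade below strictly decreases the sum of the coordinates, so the
  descent ends at a minimal grade.\<close>

lemma min_grade_below:
  assumes "s \<in> supp Ks \<sigma>"
  shows "\<exists>a\<in>min_grades Ks \<sigma>. a \<le> s"
  using assms
proof (induction s rule: measure_induct_rule[where f = "\<lambda>s. fst s + snd s"])
  case (less s)
  show ?case
  proof (cases "s \<in> min_grades Ks \<sigma>")
    case False
    then obtain t where t: "t \<in> supp Ks \<sigma>" "t \<le> s" "t \<noteq> s"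
      using less.prems unfolding min_grades_def by auto
    then have "fst t + snd t < fst s + snd s"
      by (cases t; cases s) auto
    with less.IH[OF _ t(1)] t(2) show ?thesis by (meson order_trans)
  qed blast
qed

lemma min_grades_antichain:
  "x \<in> min_grades Ks \<sigma> \<Longrightarrow> y \<in> min_grades Ks \<sigma> \<Longrightarrow> x \<le> y \<Longrightarrow> x = y"
  unfolding min_grades_def by blast

text \<open>Two grades that share a coordinate are comparable, and comparable minimal grades
  coincide.\<close>

lemma inj_on_fst_min_grades: "inj_on fst (min_grades Ks \<sigma>)"
  and inj_on_snd_min_grades: "inj_on snd (min_grades Ks \<sigma>)"
proof -
  show "inj_on fst (min_grades Ks \<sigma>)"
  proof (rule inj_onI)
    fix x y assume "x \<in> min_grades Ks \<sigma>" "y \<in> min_grades Ks \<sigma>" "fst x = fst y"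
    moreover from this(3) have "x \<le> y \<or> y \<le> x" by (auto simp: less_eq_prod_def)
    ultimately show "x = y" using min_grades_antichain by metis
  qed
  show "inj_on snd (min_grades Ks \<sigma>)"
  proof (rule inj_onI)
    fix x y assume "x \<in> min_grades Ks \<sigma>" "y \<in> min_grades Ks \<sigma>" "snd x = snd y"
    moreover from this(3) have "x \<le> y \<or> y \<le> x" by (auto simp: less_eq_prod_def)
    ultimately show "x = y" using min_grades_antichain by metis
  qed
qed

text \<open>No minimal grade exceeds a fixed one \<open>x\<close>, so each has its first or its second coordinate bounded
  by that of \<open>x\<close>, and either coordinate determines it.\<close>
lemma finite_min_grades: "finite (min_grades Ks \<sigma>)"
proof (cases "min_grades Ks \<sigma> = {}")
  case False
  then obtain x where x: "x \<in> min_grades Ks \<sigma>" by blast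
  let ?A = "{y \<in> min_grades Ks \<sigma>. fst y \<le> fst x}" and ?B = "{y \<in> min_grades Ks \<sigma>. snd y \<le> snd x}"
  have "finite (fst ` ?A)" "finite (snd ` ?B)"
    by (auto intro: finite_subset[of _ "{..fst x}"] finite_subset[of _ "{..snd x}"])
  then have "finite ?A" "finite ?B"
    by (auto intro: finite_imageD inj_on_subset[OF inj_on_fst_min_grades] inj_on_subset[OF inj_on_snd_min_grades])
  moreover have "min_grades Ks \<sigma> \<subseteq> ?A \<union> ?B"
  proof
    fix y assume y: "y \<in> min_grades Ks \<sigma>"
    show "y \<in> ?A \<union> ?B"
    proof (rule ccontr)
      assume "y \<notin> ?A \<union> ?B"
      then have "x \<le> y" "x \<noteq> y" using y by (auto simp: less_eq_prod_def)
      then show False using min_grades_antichain[OF x y] by blast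
    qed
  qed
  ultimately show ?thesis by (meson finite_Un finite_subset)
qed simp

text \<open>Injectivity of the key makes sorted insertions commute, so that folding them over a set
  is well defined.\<close>

lemma (in linorder) sorted_key_list_of_set_inj_on:
  assumes "inj_on f S" and "finite S"
  shows "set (sorted_key_list_of_set f S) = S"
    and "sorted (map f (sorted_key_list_of_set f S))"
proof -
  interpret m: folding_insort_key "(\<le>)" "(<)" S f
    by unfold_locales fact
  show "set (sorted_key_list_of_set f S) = S"
    using assms(2) by (rule m.set_sorted_key_list_of_set[OF subset_refl])
  show "sorted (map f (sorted_key_list_of_set f S))"
    by (rule m.sorted_sorted_key_list_of_set[OF subset_refl])
qed

lemma set_gen_grades: "set (gen_grades Ks \<sigma>) = min_grades Ks \<sigma>"
  and sorted_gen_grades: "sorted (map fst (gen_grades Ks \<sigma>))"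
  unfolding gen_grades_def
  by (rule sorted_key_list_of_set_inj_on[OF inj_on_fst_min_grades finite_min_grades])+

lemma gen_grades_fst_mono:
  "j \<le> k \<Longrightarrow> k < length (gen_grades Ks \<sigma>) \<Longrightarrow> fst (gen_grades Ks \<sigma> ! j) \<le> fst (gen_grades Ks \<sigma> ! k)"
  using sorted_nth_mono[OF sorted_gen_grades, of j k Ks \<sigma>] by simp

text \<open>If the second coordinate grew together with the first, two distinct minimal grades would
  be comparable.\<close>

lemma gen_grades_snd_antimono:
  assumes "j \<le> k" and "k < length (gen_grades Ks \<sigma>)"
  shows "snd (gen_grades Ks \<sigma> ! k) \<le> snd (gen_grades Ks \<sigma> ! j)"
proof (rule ccontr)
  assume neg: "\<not> ?thesis"
  then have "gen_grades Ks \<sigma> ! j \<le> gen_grades Ks \<sigma> ! k"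
    using gen_grades_fst_mono[OF assms] by (auto simp: less_eq_prod_def)
  moreover have "gen_grades Ks \<sigma> ! j \<in> min_grades Ks \<sigma>" "gen_grades Ks \<sigma> ! k \<in> min_grades Ks \<sigma>"
    using assms by (auto simp flip: set_gen_grades)
  ultimately show False using min_grades_antichain neg by fastforce
qed

text \<open>The first coordinate at \<open>k\<close> is bounded by that at the right end
  \<open>l\<close>, the second by that at the left end \<open>j\<close>. Hence the active generators
  of a simplex form an interval.\<close>

lemma gen_grades_convex:
  assumes "j \<le> k" and "k \<le> l" and "l < length (gen_grades Ks \<sigma>)"
    and "gen_grades Ks \<sigma> ! j \<le> s" and "gen_grades Ks \<sigma> ! l \<le> s"
  shows "gen_grades Ks \<sigma> ! k \<le> s"
  using gen_grades_fst_mono[of k l Ks \<sigma>] gen_grades_snd_antimono[of j k Ks \<sigma>] assms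
  by (auto simp: less_eq_prod_def)

section \<open>Faces\<close>

text \<open>Exactly two vertices of \<open>\<sigma>\<close> are missing from \<open>\<tau>\<close>;
  a facet in between arises by adding one of them.\<close>

lemma codim2_face_facets:
  assumes fin: "finite \<sigma>" and \<tau>: "\<tau> \<in> codim2_faces \<sigma>"
  obtains \<rho>1 \<rho>2 where "\<rho>1 \<noteq> \<rho>2" and "{\<rho> \<in> facets \<sigma>. \<tau> \<in> facets \<rho>} = {\<rho>1, \<rho>2}"
proof -
  have sub: "\<tau> \<subseteq> \<sigma>" "\<tau> \<noteq> {}" "card \<tau> + 2 = card \<sigma>" using \<tau> unfolding codim2_faces_def by auto
  have fin\<tau>: "finite \<tau>" using fin sub(1) finite_subset by blast
  have "card (\<sigma> - \<tau>) = 2" using sub fin\<tau> by (simp add: card_Diff_subset)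
  then obtain a b where ab: "\<sigma> - \<tau> = {a, b}" "a \<noteq> b" by (auto simp: card_2_iff)
  then have notin: "a \<notin> \<tau>" "b \<notin> \<tau>" "a \<in> \<sigma>" "b \<in> \<sigma>" by auto
  have "\<rho> \<in> {insert a \<tau>, insert b \<tau>}" if "\<rho> \<in> facets \<sigma>" "\<tau> \<in> facets \<rho>" for \<rho>
  proof -
    have \<rho>: "\<rho> \<subseteq> \<sigma>" "\<tau> \<subseteq> \<rho>" "card \<rho> = Suc (card \<tau>)" using that unfolding facets_def by auto
    then have "card (\<rho> - \<tau>) = 1" using fin\<tau> by (simp add: card_Diff_subset)
    then obtain c where c: "\<rho> - \<tau> = {c}" by (auto simp: card_1_singleton_iff)
    then have "c \<in> {a, b}" using \<rho>(1) ab(1) by blast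
    moreover have "\<rho> = insert c \<tau>" using c \<rho>(2) by blast
    ultimately show ?thesis by auto
  qed
  moreover have "insert c \<tau> \<in> facets \<sigma>" "\<tau> \<in> facets (insert c \<tau>)" if "c \<in> {a, b}" for c
    using that notin sub fin\<tau> unfolding facets_def by auto
  ultimately have "{\<rho> \<in> facets \<sigma>. \<tau> \<in> facets \<rho>} = {insert a \<tau>, insert b \<tau>}"
    by (intro equalityI subsetI) auto
  moreover have "insert a \<tau> \<noteq> insert b \<tau>" using notin ab(2) by blast
  ultimately show thesis by (intro that)
qed

lemma facet_of_facet: "\<rho> \<in> facets \<sigma> \<Longrightarrow> \<tau> \<in> facets \<rho> \<Longrightarrow> \<tau> \<in> codim2_faces \<sigma>"
  unfolding facets_def codim2_faces_def by auto

lemma finite_facets: "finite \<sigma> \<Longrightarrow> finite (facets \<sigma>)"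
  and finite_codim2_faces: "finite \<sigma> \<Longrightarrow> finite (codim2_faces \<sigma>)"
  unfolding facets_def codim2_faces_def by (auto intro: finite_subset[of _ "Pow \<sigma>"])

lemma connecting_path_commute: "connecting_path \<tau> j l = connecting_path \<tau> l j"
  unfolding connecting_path_def by (simp add: min.commute max.commute)

section \<open>Free modules\<close>

lemma carrier_free_on:
  "finite B \<Longrightarrow> carrier (obj (free_on B gr) s) = vecs {b \<in> B. gr b \<le> s}"
  unfolding free_on_def by (simp add: carrier_direct_sum_upset_finite)

lemma unit_vec_eq_iff [simp]: "unit_vec b = unit_vec c \<longleftrightarrow> b = c"
  unfolding unit_vec_def by (auto simp: fun_eq_iff split: if_splits)

lemma unit_vec_neq_0 [simp]: "unit_vec b \<noteq> 0"
  unfolding unit_vec_def by (auto simp: fun_eq_iff)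

text \<open>\<open>free_pmodule\<close> wants a basis indexed by pairs of a grade and an element of
  the module. The disjoint union of \<open>A\<close> and \<open>B\<close> is therefore encoded by
  sending each index to its grade and its unit vector in the sum; the two images are disjoint
  because unit vectors are nonzero.\<close>

lemma free_pmodule_direct_sum2:
  fixes A :: "'i set" and B :: "'j set"
  assumes A: "finite A" and B: "finite B"
  shows "free_pmodule (direct_sum2 (free_on A g) (free_on B h))"
proof -
  define e1 :: "'i \<Rightarrow> grade \<times> ('i \<Rightarrow> bit) \<times> ('j \<Rightarrow> bit)" where "e1 b = (g b, unit_vec b, 0)" for b
  define e2 :: "'j \<Rightarrow> grade \<times> ('i \<Rightarrow> bit) \<times> ('j \<Rightarrow> bit)" where "e2 b = (h b, 0, unit_vec b)" for b
  define E where "E = e1 ` A \<union> e2 ` B"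
  define \<phi> where "\<phi> s w = (\<lambda>b. w (e1 b), \<lambda>b. w (e2 b))"
    for s :: grade and w :: "grade \<times> ('i \<Rightarrow> bit) \<times> ('j \<Rightarrow> bit) \<Rightarrow> bit"
  \<comment> \<open>The inverse of \<open>\<phi>\<close>, which reads coefficients back along
    \<open>e1\<close> and \<open>e2\<close>. The default 0 is right because vectors on the source
    side vanish off \<open>E\<close>.\<close>
  define \<psi> where "\<psi> = (\<lambda>(v, r) e. if e \<in> range e1 then v (inv_into UNIV e1 e)
    else if e \<in> range e2 then r (inv_into UNIV e2 e) else (0 :: bit))"
  have inj: "inj e1" "inj e2" unfolding inj_def e1_def e2_def by auto
  have disj: "e1 b \<noteq> e2 c" for b c unfolding e1_def e2_def by auto
  have mem: "e1 b \<in> E \<longleftrightarrow> b \<in> A" "e2 c \<in> E \<longleftrightarrow> c \<in> B" for b c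
    unfolding E_def using inj disj disj[symmetric] by (auto dest: injD)
  have grade: "fst (e1 b) = g b" "fst (e2 c) = h c" for b c by (simp_all add: e1_def e2_def)
  have \<psi>: "\<psi> (v, r) (e1 b) = v b" "\<psi> (v, r) (e2 c) = r c" for v r b c
    using inj disj disj[symmetric] unfolding \<psi>_def by (auto simp: inv_into_f_f)
  have \<psi>0: "\<psi> (v, r) e = 0" if "e \<notin> range e1" "e \<notin> range e2" for v r e
    using that unfolding \<psi>_def by simp
  have incl: "inclusion_module (free_on E fst)"
    "inclusion_module (direct_sum2 (free_on A g) (free_on B h))"
    unfolding free_on_def by (intro inclusion_direct_sum2 inclusion_direct_sum_upset)+
  have finE: "finite E" unfolding E_def using A B by simp
  have carr: "carrier (obj (direct_sum2 (free_on A g) (free_on B h)) s) =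
      vecs {b \<in> A. g b \<le> s} \<times> vecs {b \<in> B. h b \<le> s}" for s
    unfolding direct_sum2_def by (simp add: carrier_free_on A B)
  have \<phi>_mem: "\<phi> s w \<in> vecs {b \<in> A. g b \<le> s} \<times> vecs {b \<in> B. h b \<le> s}"
    if "w \<in> vecs {e \<in> E. fst e \<le> s}" for s w
    using that mem grade unfolding \<phi>_def vecs_def by fastforce
  have \<psi>_mem: "\<psi> x \<in> vecs {e \<in> E. fst e \<le> s}"
    if "x \<in> vecs {b \<in> A. g b \<le> s} \<times> vecs {b \<in> B. h b \<le> s}" for s x
  proof -
    obtain v r where x: "x = (v, r)" by (cases x)
    have "e \<in> {e \<in> E. fst e \<le> s}" if nz: "\<psi> (v, r) e \<noteq> 0" for e
    proof -
      consider b where "e = e1 b" | c where "e = e2 c" using nz \<psi>0 by blast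
      then show ?thesis
        using nz \<open>x \<in> _\<close> unfolding x vecs_def by cases (auto simp: \<psi> mem grade)
    qed
    then show ?thesis unfolding vecs_def x by blast
  qed
  have "bij_betw (\<phi> s) (vecs {e \<in> E. fst e \<le> s}) (vecs {b \<in> A. g b \<le> s} \<times> vecs {b \<in> B. h b \<le> s})" for s
  proof (rule bij_betw_byWitness[where f' = \<psi>])
    show "\<forall>w\<in>vecs {e \<in> E. fst e \<le> s}. \<psi> (\<phi> s w) = w"
    proof
      fix w assume w: "w \<in> vecs {e \<in> E. fst e \<le> s}"
      have "\<psi> (\<phi> s w) e = w e" for e
      proof -
        consider b where "e = e1 b" | c where "e = e2 c" | "e \<notin> range e1" "e \<notin> range e2" by blast
        then show ?thesis
        proof cases
          case 3
          then have "e \<notin> E" unfolding E_def by blast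
          then have "w e = 0" using w unfolding vecs_def by blast
          with 3 show ?thesis unfolding \<phi>_def by (simp add: \<psi>0)
        qed (simp_all add: \<phi>_def \<psi>)
      qed
      then show "\<psi> (\<phi> s w) = w" by blast
    qed
    show "\<forall>x\<in>vecs {b \<in> A. g b \<le> s} \<times> vecs {b \<in> B. h b \<le> s}. \<phi> s (\<psi> x) = x"
      unfolding \<phi>_def by (auto simp: \<psi>)
  qed (use \<phi>_mem \<psi>_mem in blast)+
  moreover have "pmorphism (free_on E fst) (direct_sum2 (free_on A g) (free_on B h)) \<phi>"
    unfolding pmorphism_inclusion[OF incl] carr carrier_free_on[OF finE]
    using \<phi>_mem by (auto simp: \<phi>_def fun_eq_iff)
  ultimately have "pisomorphism (free_on E fst) (direct_sum2 (free_on A g) (free_on B h)) \<phi>"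
    unfolding pisomorphism_def carr carrier_free_on[OF finE] by blast
  then show ?thesis unfolding free_pmodule_def by blast
qed

section \<open>The path construction\<close>

locale path_construction =
  fixes K :: "'v set set" and Ks :: "grade \<Rightarrow> 'v set set"
    and z :: "'v set \<Rightarrow> nat \<Rightarrow> 'v set \<Rightarrow> nat"
  assumes bifiltration: "simplicial_bifiltration K Ks"
    and choice: "facet_choice K Ks z"
begin

section \<open>Maps and the basis elements active at a grade\<close>

abbreviation gg :: "'v set \<Rightarrow> grade list" where "gg \<equiv> gen_grades Ks"
abbreviation f0 where "f0 \<equiv> f0_map K Ks z"
abbreviation f1 where "f1 \<equiv> f1_map K Ks z"
abbreviation h0 where "h0 \<equiv> h0_map K Ks z"
abbreviation p1 where "p1 \<equiv> p1_map K Ks"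

definition \<epsilon> :: "int \<Rightarrow> ('v set \<times> nat \<Rightarrow> bit) \<Rightarrow> 'v set \<Rightarrow> bit" where
  "\<epsilon> i = linear_extension (gen_basis K Ks i) (\<lambda>(\<sigma>, j). unit_vec \<sigma>)"

text \<open>The differential of \<open>bifiltered_complex\<close>, without its idle grade
  argument.\<close>

definition bd :: "int \<Rightarrow> ('v set \<Rightarrow> bit) \<Rightarrow> 'v set \<Rightarrow> bit" where
  "bd i = linear_extension (simplices K i) (\<lambda>\<sigma>. \<Sum>\<tau>\<in>facets \<sigma>. unit_vec \<tau>)"

text \<open>The sets \<open>gens\<close>, \<open>rels\<close> and \<open>cells\<close> index what is
  active at grade \<open>s\<close>: \<open>vecs\<close> of them are the grade spaces of the
  generator module, the relation module and the bifiltered complex.\<close>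

definition gens :: "int \<Rightarrow> grade \<Rightarrow> ('v set \<times> nat) set" where
  "gens i s = {b \<in> gen_basis K Ks i. gen_grade Ks b \<le> s}"

definition rels :: "int \<Rightarrow> grade \<Rightarrow> ('v set \<times> nat) set" where
  "rels i s = {b \<in> rel_basis K Ks i. rel_grade Ks b \<le> s}"

definition cells :: "int \<Rightarrow> grade \<Rightarrow> 'v set set" where
  "cells i s = {\<sigma> \<in> simplices K i. \<exists>a\<in>min_grades Ks \<sigma>. a \<le> s}"

lemma gen_basis_iff: "(\<sigma>, j) \<in> gen_basis K Ks i \<longleftrightarrow> \<sigma> \<in> simplices K i \<and> j < length (gg \<sigma>)"
  unfolding gen_basis_def by auto

lemma rel_basis_iff: "(\<sigma>, j) \<in> rel_basis K Ks i \<longleftrightarrow> \<sigma> \<in> simplices K i \<and> Suc j < length (gg \<sigma>)"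
  unfolding rel_basis_def by auto

lemma gens_iff: "(\<sigma>, j) \<in> gens i s \<longleftrightarrow> \<sigma> \<in> simplices K i \<and> j < length (gg \<sigma>) \<and> gg \<sigma> ! j \<le> s"
  unfolding gens_def gen_grade_def by (auto simp: gen_basis_iff)

text \<open>A supremum lies below \<open>s\<close> iff both joined grades do, so a relation is
  active exactly when both of its end generators are.\<close>

lemma rels_iff: "(\<sigma>, j) \<in> rels i s \<longleftrightarrow>
    \<sigma> \<in> simplices K i \<and> Suc j < length (gg \<sigma>) \<and> gg \<sigma> ! j \<le> s \<and> gg \<sigma> ! Suc j \<le> s"
  unfolding rels_def rel_grade_def by (auto simp: rel_basis_iff)

lemma gens_subset: "gens i s \<subseteq> gen_basis K Ks i"
  and rels_subset: "rels i s \<subseteq> rel_basis K Ks i"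
  and cells_subset: "cells i s \<subseteq> simplices K i"
  unfolding gens_def rels_def cells_def by auto

lemmas gens_vecs = vecs_mono[OF gens_subset]
  and rels_vecs = vecs_mono[OF rels_subset]

section \<open>Finiteness and faces in the bifiltration\<close>

lemma finite_K: "finite K"
  and finite_simplex_K: "\<sigma> \<in> K \<Longrightarrow> finite \<sigma>"
  and face_K: "\<sigma> \<in> K \<Longrightarrow> \<tau> \<noteq> {} \<Longrightarrow> \<tau> \<subseteq> \<sigma> \<Longrightarrow> \<tau> \<in> K"
  and face_Ks: "\<sigma> \<in> Ks s \<Longrightarrow> \<tau> \<noteq> {} \<Longrightarrow> \<tau> \<subseteq> \<sigma> \<Longrightarrow> \<tau> \<in> Ks s"
  and Ks_mono: "s \<le> t \<Longrightarrow> \<sigma> \<in> Ks s \<Longrightarrow> \<sigma> \<in> Ks t"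
proof -
  have bif: "finite K" "abstract_complex K" "\<And>s. abstract_complex (Ks s)"
    "\<And>s t. s \<le> t \<Longrightarrow> Ks s \<subseteq> Ks t"
    using bifiltration unfolding simplicial_bifiltration_def by simp_all
  show "finite K" by (rule bif)
  show "finite \<sigma>" if "\<sigma> \<in> K"
    using bspec[OF conjunct1[OF bif(2)[unfolded abstract_complex_def]] that] by (rule conjunct1)
  have face: "\<tau> \<in> L" if "abstract_complex L" "\<sigma> \<in> L" "\<tau> \<noteq> {}" "\<tau> \<subseteq> \<sigma>" for L
  proof -
    have "\<forall>\<tau>. \<tau> \<noteq> {} \<and> \<tau> \<subseteq> \<sigma> \<longrightarrow> \<tau> \<in> L"
      by (rule bspec[OF conjunct2[OF that(1)[unfolded abstract_complex_def]] that(2)])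
    with that(3,4) show ?thesis by simp
  qed
  show "\<tau> \<in> K" if "\<sigma> \<in> K" "\<tau> \<noteq> {}" "\<tau> \<subseteq> \<sigma>"
    using bif(2) that by (rule face)
  show "\<tau> \<in> Ks s" if "\<sigma> \<in> Ks s" "\<tau> \<noteq> {}" "\<tau> \<subseteq> \<sigma>"
    using bif(3) that by (rule face)
  show "\<sigma> \<in> Ks t" if "s \<le> t" "\<sigma> \<in> Ks s"
    using bif(4)[OF that(1)] that(2) by (rule subsetD)
qed

lemma finite_simplices: "finite (simplices K i)"
  unfolding simplices_def using finite_K by simp

lemma finite_gen_basis: "finite (gen_basis K Ks i)"
  and finite_rel_basis: "finite (rel_basis K Ks i)"
proof -
  show gen: "finite (gen_basis K Ks i)"
    unfolding gen_basis_def by (intro finite_SigmaI finite_simplices) simp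
  show "finite (rel_basis K Ks i)"
    by (rule finite_subset[OF _ gen]) (auto simp: gen_basis_def rel_basis_def)
qed

lemma finite_simplex: "\<sigma> \<in> simplices K i \<Longrightarrow> finite \<sigma>"
  unfolding simplices_def using finite_simplex_K by blast

lemma facet_simplex: "\<sigma> \<in> simplices K i \<Longrightarrow> \<tau> \<in> facets \<sigma> \<Longrightarrow> \<tau> \<in> simplices K (i - 1)"
  unfolding simplices_def facets_def using face_K by auto

text \<open>The support is an upset generated by its minimal elements. So \<open>cells i s\<close>
  consists of the \<open>i\<close>-simplices of \<open>Ks s\<close>.\<close>

lemma grade_below_iff: "(\<exists>a\<in>min_grades Ks \<sigma>. a \<le> s) \<longleftrightarrow> \<sigma> \<in> Ks s"
proof
  assume "\<exists>a\<in>min_grades Ks \<sigma>. a \<le> s"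
  then obtain a where "\<sigma> \<in> Ks a" "a \<le> s" unfolding min_grades_def supp_def by blast
  then show "\<sigma> \<in> Ks s" using Ks_mono by blast
next
  assume "\<sigma> \<in> Ks s"
  then show "\<exists>a\<in>min_grades Ks \<sigma>. a \<le> s" by (intro min_grade_below) (simp add: supp_def)
qed

lemma facet_cell:
  assumes "\<sigma> \<in> cells i s" and "\<tau> \<in> facets \<sigma>"
  shows "\<tau> \<in> cells (i - 1) s"
proof -
  have "\<tau> \<noteq> {}" "\<tau> \<subseteq> \<sigma>"
    using assms(2) unfolding facets_def by auto
  then show ?thesis
    using assms facet_simplex face_Ks unfolding cells_def grade_below_iff by blast
qed

text \<open>The generator chosen in a facet has a grade below that of the original one, so activity
  at \<open>s\<close> is inherited.\<close>

lemma facet_gens: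
  assumes "(\<sigma>, j) \<in> gens i s" and "\<tau> \<in> facets \<sigma>"
  shows "(\<tau>, z \<sigma> j \<tau>) \<in> gens (i - 1) s"
proof -
  have \<sigma>: "\<sigma> \<in> simplices K i" "j < length (gg \<sigma>)" "gg \<sigma> ! j \<le> s"
    using assms(1) by (simp_all add: gens_iff)
  then have "\<sigma> \<in> K" by (simp add: simplices_def)
  then have "z \<sigma> j \<tau> < length (gg \<tau>)" "gg \<tau> ! z \<sigma> j \<tau> \<le> gg \<sigma> ! j"
    using choice \<sigma>(2) assms(2) unfolding facet_choice_def by blast+
  then show ?thesis
    using \<sigma> facet_simplex[OF \<sigma>(1) assms(2)] by (auto simp: gens_iff intro: order_trans)
qed

lemma facet_gen_basis:
  assumes "(\<sigma>, j) \<in> gen_basis K Ks i" and "\<tau> \<in> facets \<sigma>"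
  shows "(\<tau>, z \<sigma> j \<tau>) \<in> gen_basis K Ks (i - 1)"
proof -
  \<comment> \<open>Every generator is active at its own grade, which reduces the ungraded claim to
    the graded one.\<close>
  have "(\<sigma>, j) \<in> gens i (gg \<sigma> ! j)" using assms(1) by (simp add: gens_iff gen_basis_iff)
  from facet_gens[OF this assms(2)] show ?thesis using gens_subset by blast
qed

section \<open>Additivity and values on basis vectors\<close>

lemma additive_maps:
  "Modules.additive (f0 i)" "Modules.additive (f1 i)" "Modules.additive (h0 i)"
  "Modules.additive (p1 i)" "Modules.additive (\<epsilon> i)" "Modules.additive (bd i)"
  unfolding f0_map_def f1_map_def h0_map_def p1_map_def \<epsilon>_def bd_def
  by (rule additive_linear_extension)+

lemmas map_add = additive_maps[THEN additive.add]
lemmas map_sum = additive_maps[THEN additive.sum]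

lemma f0_unit: "(\<sigma>, j) \<in> gen_basis K Ks i \<Longrightarrow>
    f0 i (unit_vec (\<sigma>, j)) = (\<Sum>\<tau>\<in>facets \<sigma>. unit_vec (\<tau>, z \<sigma> j \<tau>))"
  unfolding f0_map_def by (simp add: linear_extension_unit_vec[OF finite_gen_basis])

lemma h0_unit: "(\<sigma>, j) \<in> gen_basis K Ks i \<Longrightarrow>
    h0 i (unit_vec (\<sigma>, j)) = (\<Sum>\<tau>\<in>codim2_faces \<sigma>.
      connecting_path \<tau> (Min (contributions z \<sigma> j \<tau>)) (Max (contributions z \<sigma> j \<tau>)))"
  unfolding h0_map_def by (simp add: linear_extension_unit_vec[OF finite_gen_basis])

lemma f1_unit: "(\<sigma>, j) \<in> rel_basis K Ks i \<Longrightarrow>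
    f1 i (unit_vec (\<sigma>, j)) = (\<Sum>\<tau>\<in>facets \<sigma>. connecting_path \<tau> (z \<sigma> j \<tau>) (z \<sigma> (Suc j) \<tau>))"
  unfolding f1_map_def by (simp add: linear_extension_unit_vec[OF finite_rel_basis])

lemma p1_unit: "(\<sigma>, j) \<in> rel_basis K Ks i \<Longrightarrow>
    p1 i (unit_vec (\<sigma>, j)) = unit_vec (\<sigma>, j) + unit_vec (\<sigma>, Suc j)"
  unfolding p1_map_def by (simp add: linear_extension_unit_vec[OF finite_rel_basis] fun_eq_iff)

lemma \<epsilon>_unit: "(\<sigma>, j) \<in> gen_basis K Ks i \<Longrightarrow> \<epsilon> i (unit_vec (\<sigma>, j)) = unit_vec \<sigma>"
  unfolding \<epsilon>_def by (simp add: linear_extension_unit_vec[OF finite_gen_basis])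

lemma bd_unit: "\<sigma> \<in> simplices K i \<Longrightarrow> bd i (unit_vec \<sigma>) = (\<Sum>\<tau>\<in>facets \<sigma>. unit_vec \<tau>)"
  unfolding bd_def by (simp add: linear_extension_unit_vec[OF finite_simplices])

lemma codim2_contributions:
  assumes "\<sigma> \<in> simplices K i" and "\<tau> \<in> codim2_faces \<sigma>"
  obtains \<rho>1 \<rho>2 where "\<rho>1 \<noteq> \<rho>2" and "{\<rho> \<in> facets \<sigma>. \<tau> \<in> facets \<rho>} = {\<rho>1, \<rho>2}"
    and "contributions z \<sigma> j \<tau> = {z \<rho>1 (z \<sigma> j \<rho>1) \<tau>, z \<rho>2 (z \<sigma> j \<rho>2) \<tau>}"
proof -
  obtain \<rho>1 \<rho>2 where \<rho>: "\<rho>1 \<noteq> \<rho>2" "{\<rho> \<in> facets \<sigma>. \<tau> \<in> facets \<rho>} = {\<rho>1, \<rho>2}"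
    using codim2_face_facets[OF finite_simplex[OF assms(1)] assms(2)] .
  have "contributions z \<sigma> j \<tau> = (\<lambda>\<rho>. z \<rho> (z \<sigma> j \<rho>) \<tau>) ` {\<rho> \<in> facets \<sigma>. \<tau> \<in> facets \<rho>}"
    unfolding contributions_def by auto
  then have "contributions z \<sigma> j \<tau> = {z \<rho>1 (z \<sigma> j \<rho>1) \<tau>, z \<rho>2 (z \<sigma> j \<rho>2) \<tau>}"
    unfolding \<rho>(2) by simp
  with \<rho> show thesis by (rule that)
qed

text \<open>Minimum and maximum are themselves contributions, and each contribution is reached by
  applying \<open>facet_gens\<close> twice.\<close>

lemma contributions_gens:
  assumes "(\<sigma>, j) \<in> gens i s" and "\<tau> \<in> codim2_faces \<sigma>"
  shows "(\<tau>, Min (contributions z \<sigma> j \<tau>)) \<in> gens (i - 2) s"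
    and "(\<tau>, Max (contributions z \<sigma> j \<tau>)) \<in> gens (i - 2) s"
proof -
  have \<sigma>: "\<sigma> \<in> simplices K i" using assms(1) by (simp add: gens_iff)
  obtain \<rho>1 \<rho>2 where "\<rho>1 \<noteq> \<rho>2" and \<rho>: "{\<rho> \<in> facets \<sigma>. \<tau> \<in> facets \<rho>} = {\<rho>1, \<rho>2}"
    and c: "contributions z \<sigma> j \<tau> = {z \<rho>1 (z \<sigma> j \<rho>1) \<tau>, z \<rho>2 (z \<sigma> j \<rho>2) \<tau>}"
    using codim2_contributions[OF \<sigma> assms(2)] .
  have "(\<tau>, z \<rho> (z \<sigma> j \<rho>) \<tau>) \<in> gens (i - 2) s" if "\<rho> \<in> {\<rho>1, \<rho>2}" for \<rho>
  proof -
    have "\<rho> \<in> facets \<sigma>" "\<tau> \<in> facets \<rho>" using that unfolding \<rho>[symmetric] by auto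
    then show ?thesis using facet_gens[OF facet_gens[OF assms(1)]] by (simp add: diff_diff_eq)
  qed
  then have "q \<in> contributions z \<sigma> j \<tau> \<Longrightarrow> (\<tau>, q) \<in> gens (i - 2) s" for q
    unfolding c by auto
  moreover have "finite (contributions z \<sigma> j \<tau>)" "contributions z \<sigma> j \<tau> \<noteq> {}"
    unfolding c by auto
  ultimately show "(\<tau>, Min (contributions z \<sigma> j \<tau>)) \<in> gens (i - 2) s"
    "(\<tau>, Max (contributions z \<sigma> j \<tau>)) \<in> gens (i - 2) s"
    using Min_in Max_in by blast+
qed

text \<open>By convexity all generators between two active ones are active, hence so are both ends
  of each relation on the path.\<close>

lemma path_vecs:
  assumes "(\<sigma>, j) \<in> gens i s" and "(\<sigma>, l) \<in> gens i s"
  shows "connecting_path \<sigma> j l \<in> vecs (rels i s)"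
proof -
  have path: "connecting_path \<sigma> j l \<in> vecs (rels i s)"
    if le: "(\<sigma>, j) \<in> gens i s" "(\<sigma>, l) \<in> gens i s" "j \<le> l" for j l
    unfolding connecting_path_def
  proof (rule vecs_sum)
    fix k assume k: "k \<in> {min j l..<max j l}"
    have "gg \<sigma> ! k' \<le> s" if "k' \<in> {k, Suc k}" for k'
      by (rule gen_grades_convex[of j k' l]) (use that k le in \<open>auto simp: gens_iff\<close>)
    then show "unit_vec (\<sigma>, k) \<in> vecs (rels i s)"
      using k le unfolding vecs_unit_vec rels_iff gens_iff by auto
  qed
  show ?thesis
    using path[OF assms] path[OF assms(2,1)] connecting_path_commute[of \<sigma> j l] by (cases "j \<le> l") auto
qed

section \<open>The maps respect grades\<close>

lemma f0_vecs: "v \<in> vecs (gens i s) \<Longrightarrow> f0 i v \<in> vecs (gens (i - 1) s)"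
  unfolding f0_map_def
  by (erule linear_extension_vecs) (auto intro!: vecs_sum simp: vecs_unit_vec facet_gens)

lemma p1_vecs: "v \<in> vecs (rels i s) \<Longrightarrow> p1 i v \<in> vecs (gens i s)"
  unfolding p1_map_def
  by (erule linear_extension_vecs) (auto intro!: vecs_add simp: vecs_unit_vec rels_iff gens_iff)

lemma f1_vecs: "v \<in> vecs (rels i s) \<Longrightarrow> f1 i v \<in> vecs (rels (i - 1) s)"
  unfolding f1_map_def
  by (erule linear_extension_vecs)
    (auto intro!: vecs_sum path_vecs facet_gens simp: rels_iff gens_iff[of _ _ i])

lemma h0_vecs: "v \<in> vecs (gens i s) \<Longrightarrow> h0 i v \<in> vecs (rels (i - 2) s)"
  unfolding h0_map_def
  by (erule linear_extension_vecs) (auto intro!: vecs_sum path_vecs contributions_gens)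

lemma \<epsilon>_vecs: "v \<in> vecs (gens i s) \<Longrightarrow> \<epsilon> i v \<in> vecs (cells i s)"
  unfolding \<epsilon>_def
  by (erule linear_extension_vecs)
    (auto simp: vecs_unit_vec gens_iff cells_def simp flip: set_gen_grades intro: bexI[OF _ nth_mem])

lemma bd_vecs: "v \<in> vecs (cells i s) \<Longrightarrow> bd i v \<in> vecs (cells (i - 1) s)"
  unfolding bd_def
  by (erule linear_extension_vecs) (auto intro!: vecs_sum simp: vecs_unit_vec facet_cell)

section \<open>The ends of a path, and exactness of \<open>0 -> R -> G -> C -> 0\<close>\<close>

lemma p1_path:
  assumes "\<sigma> \<in> simplices K i" and "j < length (gg \<sigma>)" and "l < length (gg \<sigma>)"
  shows "p1 i (connecting_path \<sigma> j l) = unit_vec (\<sigma>, j) + unit_vec (\<sigma>, l)"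
proof -
  have "p1 i (connecting_path \<sigma> j l) = (\<Sum>k\<in>{min j l..<max j l}. unit_vec (\<sigma>, k) + unit_vec (\<sigma>, Suc k))"
    unfolding connecting_path_def map_sum using assms
    by (intro sum.cong refl p1_unit) (auto simp: rel_basis_iff)
  also have "\<dots> = unit_vec (\<sigma>, min j l) + unit_vec (\<sigma>, max j l)"
    by (rule sum_telescope_char2) simp
  finally show ?thesis by (simp add: min_def max_def add.commute)
qed

text \<open>Position \<open>j\<close> is the left end of relation \<open>j\<close> and the right end
  of relation \<open>j - 1\<close>; at position 0 there is no preceding relation.\<close>

lemma p1_apply:
  assumes "v \<in> vecs (rel_basis K Ks i)"
  shows "p1 i v = (\<lambda>(\<sigma>, j). v (\<sigma>, j) + (case j of 0 \<Rightarrow> 0 | Suc k \<Rightarrow> v (\<sigma>, k)))"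
proof (rule additive_eqI[OF additive_maps(4) _ finite_rel_basis _ assms])
  show "Modules.additive (\<lambda>v :: 'v set \<times> nat \<Rightarrow> bit. \<lambda>(\<sigma>, j). v (\<sigma>, j) + (case j of 0 \<Rightarrow> 0 | Suc k \<Rightarrow> v (\<sigma>, k)))"
    unfolding Modules.additive_def by (auto simp: fun_eq_iff split: nat.split)
  fix b assume b: "b \<in> rel_basis K Ks i"
  obtain \<sigma> j where bj: "b = (\<sigma>, j)" by (cases b)
  have "p1 i (unit_vec b) = unit_vec (\<sigma>, j) + unit_vec (\<sigma>, Suc j)"
    using b unfolding bj by (rule p1_unit)
  also have "\<dots> = (\<lambda>(\<sigma>, j). unit_vec b (\<sigma>, j) + (case j of 0 \<Rightarrow> 0 | Suc k \<Rightarrow> unit_vec b (\<sigma>, k)))"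
    unfolding bj by (rule ext) (simp add: unit_vec_def split: nat.split prod.split)
  finally show "p1 i (unit_vec b) =
      (\<lambda>(\<sigma>, j). unit_vec b (\<sigma>, j) + (case j of 0 \<Rightarrow> 0 | Suc k \<Rightarrow> unit_vec b (\<sigma>, k)))" .
qed

text \<open>At position 0 only relation 0 contributes, so its coefficient vanishes; each further
  coefficient equals the preceding one.\<close>

lemma p1_eq_0:
  assumes v: "v \<in> vecs (rel_basis K Ks i)" and "p1 i v = 0"
  shows "v = 0"
proof -
  have eq: "v (\<sigma>, j) + (case j of 0 \<Rightarrow> 0 | Suc k \<Rightarrow> v (\<sigma>, k)) = 0" for \<sigma> j
    using fun_cong[OF assms(2), of "(\<sigma>, j)"] unfolding p1_apply[OF v] by simp
  have "v (\<sigma>, j) = 0" for \<sigma> j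
  proof (induction j)
    case 0
    show ?case using eq[of \<sigma> 0] by simp
  next
    case (Suc j)
    then show ?case using eq[of \<sigma> "Suc j"] by simp
  qed
  then show ?thesis by (simp add: fun_eq_iff split_paired_All)
qed

text \<open>Identities between relation vectors are verified after applying \<open>p1\<close>, where
  they turn into identities between generator vectors.\<close>

lemma p1_inject:
  assumes "v \<in> vecs (rels i s)" and "w \<in> vecs (rels i s)" and "p1 i v = p1 i w"
  shows "v = w"
proof -
  have "v + w = 0"
  proof (rule p1_eq_0[OF rels_vecs])
    show "v + w \<in> vecs (rels i s)" using assms(1,2) by (rule vecs_add)
    show "p1 i (v + w) = 0" by (simp add: map_add assms(3))
  qed
  then show ?thesis by (simp add: vec_add_eq_0_iff)
qed

lemma \<epsilon>_apply:
  assumes "v \<in> vecs (gen_basis K Ks i)"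
  shows "\<epsilon> i v = (\<lambda>\<sigma>. \<Sum>j<length (gg \<sigma>). v (\<sigma>, j))"
proof (rule additive_eqI[OF additive_maps(5) _ finite_gen_basis _ assms])
  show "Modules.additive (\<lambda>v :: 'v set \<times> nat \<Rightarrow> bit. \<lambda>\<sigma>. \<Sum>j<length (gg \<sigma>). v (\<sigma>, j))"
    unfolding Modules.additive_def by (auto simp: fun_eq_iff sum.distrib)
  fix b assume b: "b \<in> gen_basis K Ks i"
  obtain \<sigma> j where bj: "b = (\<sigma>, j)" by (cases b)
  have "(\<Sum>k<length (gg \<tau>). unit_vec b (\<tau>, k)) = unit_vec \<sigma> \<tau>" for \<tau>
  proof -
    have "(\<Sum>k<length (gg \<tau>). unit_vec b (\<tau>, k)) =
        (\<Sum>k<length (gg \<tau>). if k = j then of_bool (\<tau> = \<sigma>) else 0)"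
      unfolding bj unit_vec_def by (intro sum.cong) auto
    also have "\<dots> = unit_vec \<sigma> \<tau>"
      using b unfolding bj gen_basis_iff unit_vec_def by (auto simp: sum.delta)
    finally show ?thesis .
  qed
  then show "\<epsilon> i (unit_vec b) = (\<lambda>\<sigma>. \<Sum>j<length (gg \<sigma>). unit_vec b (\<sigma>, j))"
    using b by (simp add: bj \<epsilon>_unit)
qed

text \<open>The preimage under \<open>p1\<close> consists of partial sums; a nonzero partial sum has nonzero
  coefficients before and after it, so the relation is active by convexity.\<close>
lemma \<epsilon>_kernel:
  assumes v: "v \<in> vecs (gens i s)" and "\<epsilon> i v = 0"
  obtains r where "r \<in> vecs (rels i s)" and "p1 i r = v"
proof -
  define r where "r = (\<lambda>(\<sigma>, j). \<Sum>k\<le>j. v (\<sigma>, k))"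
  have total: "(\<Sum>k<length (gg \<sigma>). v (\<sigma>, k)) = 0" for \<sigma>
    using fun_cong[OF assms(2), of \<sigma>] unfolding \<epsilon>_apply[OF gens_vecs[OF v]] by simp
  have supp: "(\<sigma>, k) \<in> gens i s" if "v (\<sigma>, k) \<noteq> 0" for \<sigma> k
    using v that unfolding vecs_def by blast
  have "(\<sigma>, j) \<in> rels i s" if nz: "r (\<sigma>, j) \<noteq> 0" for \<sigma> j
  proof -
    have part: "(\<Sum>k\<le>j. v (\<sigma>, k)) \<noteq> 0" using nz unfolding r_def by simp
    then obtain k where k: "k \<le> j" "v (\<sigma>, k) \<noteq> 0"
      using sum.not_neutral_contains_not_neutral[of "\<lambda>k. v (\<sigma>, k)" "{..j}"] by auto
    have "\<exists>l>j. v (\<sigma>, l) \<noteq> 0"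
    proof (rule ccontr)
      assume "\<not> ?thesis"
      then have zero: "v (\<sigma>, l) = 0" if "l > j" for l using that by blast
      have beyond: "v (\<sigma>, l) = 0" if "l \<ge> length (gg \<sigma>)" for l
        using supp[of \<sigma> l] that unfolding gens_iff by fastforce
      \<comment> \<open>A common range for both sums: the partial sum extends to it by
        \<open>zero\<close>, the total sum by \<open>beyond\<close>. Without a nonzero coefficient
        after \<open>j\<close> the partial sum would thus equal the vanishing total.\<close>
      let ?N = "max (Suc j) (length (gg \<sigma>))"
      have "(\<Sum>k\<le>j. v (\<sigma>, k)) = (\<Sum>k<?N. v (\<sigma>, k))"
        by (intro sum.mono_neutral_left) (use zero in auto)
      also have "\<dots> = (\<Sum>k<length (gg \<sigma>). v (\<sigma>, k))"
        by (intro sum.mono_neutral_right) (use beyond in auto)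
      finally show False using part total by simp
    qed
    then obtain l where l: "j < l" "v (\<sigma>, l) \<noteq> 0" by blast
    have g: "(\<sigma>, k) \<in> gens i s" "(\<sigma>, l) \<in> gens i s" using supp k(2) l(2) by auto
    have "gg \<sigma> ! m \<le> s" if "m \<in> {j, Suc j}" for m
      by (rule gen_grades_convex[of k m l]) (use that g k(1) l(1) in \<open>auto simp: gens_iff\<close>)
    then show ?thesis using g l(1) unfolding rels_iff gens_iff by auto
  qed
  then have r: "r \<in> vecs (rels i s)" unfolding vecs_def by auto
  \<comment> \<open>Adding consecutive partial sums leaves the last summand.\<close>
  have "p1 i r = v"
    unfolding p1_apply[OF rels_vecs[OF r]] unfolding r_def
    by (auto simp: fun_eq_iff add_ac split: nat.split)
  with r show thesis by (rule that)
qed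

text \<open>Each simplex present at \<open>s\<close> has an active generator; picking one over each
  simplex in the support of \<open>c\<close> gives a lift.\<close>

lemma \<epsilon>_surj:
  assumes c: "c \<in> vecs (cells i s)"
  obtains g where "g \<in> vecs (gens i s)" and "\<epsilon> i g = c"
proof -
  have "\<exists>j. (\<sigma>, j) \<in> gens i s" if \<sigma>: "\<sigma> \<in> cells i s" for \<sigma>
  proof -
    obtain a where "\<sigma> \<in> simplices K i" "a \<in> set (gg \<sigma>)" "a \<le> s"
      using \<sigma> unfolding cells_def set_gen_grades by blast
    then show ?thesis unfolding gens_iff by (metis in_set_conv_nth)
  qed
  then obtain J where J: "\<And>\<sigma>. \<sigma> \<in> cells i s \<Longrightarrow> (\<sigma>, J \<sigma>) \<in> gens i s" by metis
  let ?A = "{\<sigma> \<in> cells i s. c \<sigma> \<noteq> 0}"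
  define g where "g = (\<Sum>\<sigma>\<in>?A. unit_vec (\<sigma>, J \<sigma>))"
  have "g \<in> vecs (gens i s)"
    unfolding g_def by (rule vecs_sum) (auto simp: vecs_unit_vec J)
  moreover have "\<epsilon> i g = c"
  proof -
    have "\<epsilon> i g = (\<Sum>\<sigma>\<in>?A. unit_vec \<sigma>)"
      unfolding g_def map_sum using J gens_subset by (intro sum.cong refl \<epsilon>_unit) blast
    also have "\<dots> = c"
      using vecs_expand[OF _ c] finite_subset[OF cells_subset finite_simplices] by simp
    finally show ?thesis .
  qed
  ultimately show thesis by (rule that)
qed

text \<open>Both ends of a relation lie over the same simplex and cancel.\<close>

lemma \<epsilon>_p1:
  assumes "v \<in> vecs (rel_basis K Ks i)"
  shows "\<epsilon> i (p1 i v) = 0"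
proof -
  have "\<epsilon> i (p1 i v) = (\<lambda>_. 0) v"
  proof (rule additive_eqI[OF _ _ finite_rel_basis _ assms])
    show "Modules.additive (\<lambda>v. \<epsilon> i (p1 i v))" by (rule additive_comp[OF additive_maps(5,4)])
    show "Modules.additive (\<lambda>_ :: 'v set \<times> nat \<Rightarrow> bit. 0 :: 'v set \<Rightarrow> bit)" by unfold_locales simp
    show "\<epsilon> i (p1 i (unit_vec b)) = 0" if "b \<in> rel_basis K Ks i" for b
      using that by (cases b) (simp add: p1_unit map_add \<epsilon>_unit gen_basis_iff rel_basis_iff)
  qed
  then show ?thesis by simp
qed

section \<open>Identities between the maps\<close>

lemma \<epsilon>_f0:
  assumes "v \<in> vecs (gen_basis K Ks i)"
  shows "\<epsilon> (i - 1) (f0 i v) = bd i (\<epsilon> i v)"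
proof (rule additive_eqI[OF _ _ finite_gen_basis _ assms])
  show "Modules.additive (\<lambda>v. \<epsilon> (i - 1) (f0 i v))" "Modules.additive (\<lambda>v. bd i (\<epsilon> i v))"
    by (rule additive_comp[OF additive_maps(5,1)] additive_comp[OF additive_maps(6,5)])+
  fix b assume b: "b \<in> gen_basis K Ks i"
  obtain \<sigma> j where bj: "b = (\<sigma>, j)" by (cases b)
  \<comment> \<open>Forgetting positions turns the generators chosen over the facets into the facets
    themselves.\<close>
  show "\<epsilon> (i - 1) (f0 i (unit_vec b)) = bd i (\<epsilon> i (unit_vec b))"
    using b unfolding bj by (simp add: f0_unit map_sum \<epsilon>_unit facet_gen_basis bd_unit gen_basis_iff[of \<sigma> j])
qed

text \<open>In each facet the path used by \<open>f1\<close> ends at the generators that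
  \<open>f0\<close> chooses for the two ends of the relation.\<close>

lemma f0_p1:
  assumes "v \<in> vecs (rel_basis K Ks i)"
  shows "f0 i (p1 i v) = p1 (i - 1) (f1 i v)"
proof (rule additive_eqI[OF _ _ finite_rel_basis _ assms])
  show "Modules.additive (\<lambda>v. f0 i (p1 i v))" "Modules.additive (\<lambda>v. p1 (i - 1) (f1 i v))"
    by (rule additive_comp[OF additive_maps(1,4)] additive_comp[OF additive_maps(4,2)])+
  fix b assume b: "b \<in> rel_basis K Ks i"
  obtain \<sigma> j where bj: "b = (\<sigma>, j)" by (cases b)
  have g: "(\<sigma>, j) \<in> gen_basis K Ks i" "(\<sigma>, Suc j) \<in> gen_basis K Ks i"
    using b unfolding bj gen_basis_iff rel_basis_iff by auto
  have "p1 (i - 1) (connecting_path \<tau> (z \<sigma> j \<tau>) (z \<sigma> (Suc j) \<tau>)) =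
      unit_vec (\<tau>, z \<sigma> j \<tau>) + unit_vec (\<tau>, z \<sigma> (Suc j) \<tau>)" if "\<tau> \<in> facets \<sigma>" for \<tau>
    using facet_gen_basis[OF g(1) that] facet_gen_basis[OF g(2) that]
    by (intro p1_path) (auto simp: gen_basis_iff)
  then show "f0 i (p1 i (unit_vec b)) = p1 (i - 1) (f1 i (unit_vec b))"
    using b g unfolding bj by (simp add: p1_unit f1_unit map_add f0_unit map_sum sum.distrib)
qed

text \<open>The two routes to a codimension-2 face need not end at the same generator, so they need
  not cancel as in the simplicial boundary; the path in \<open>h0\<close> joins their ends.\<close>

lemma f0_f0:
  assumes "v \<in> vecs (gen_basis K Ks i)"
  shows "f0 (i - 1) (f0 i v) = p1 (i - 2) (h0 i v)"
proof (rule additive_eqI[OF _ _ finite_gen_basis _ assms])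
  show "Modules.additive (\<lambda>v. f0 (i - 1) (f0 i v))" "Modules.additive (\<lambda>v. p1 (i - 2) (h0 i v))"
    by (rule additive_comp[OF additive_maps(1,1)] additive_comp[OF additive_maps(4,3)])+
  fix b assume b: "b \<in> gen_basis K Ks i"
  obtain \<sigma> j where bj: "b = (\<sigma>, j)" by (cases b)
  let ?u = "\<lambda>\<rho> \<tau>. unit_vec (\<tau>, z \<rho> (z \<sigma> j \<rho>) \<tau>)"
  have \<sigma>: "\<sigma> \<in> simplices K i" and fin: "finite \<sigma>"
    using b finite_simplex unfolding bj gen_basis_iff by auto
  have codim2: "p1 (i - 2) (connecting_path \<tau> (Min (contributions z \<sigma> j \<tau>)) (Max (contributions z \<sigma> j \<tau>))) =
      (\<Sum>\<rho>\<in>{\<rho> \<in> facets \<sigma>. \<tau> \<in> facets \<rho>}. ?u \<rho> \<tau>)" if \<tau>: "\<tau> \<in> codim2_faces \<sigma>" for \<tau>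
  proof -
    have "(\<sigma>, j) \<in> gens i (gg \<sigma> ! j)" using b unfolding bj by (simp add: gens_iff gen_basis_iff)
    note g = contributions_gens[OF this \<tau>]
    obtain \<rho>1 \<rho>2 where \<rho>: "\<rho>1 \<noteq> \<rho>2" "{\<rho> \<in> facets \<sigma>. \<tau> \<in> facets \<rho>} = {\<rho>1, \<rho>2}"
      and c: "contributions z \<sigma> j \<tau> = {z \<rho>1 (z \<sigma> j \<rho>1) \<tau>, z \<rho>2 (z \<sigma> j \<rho>2) \<tau>}"
      using codim2_contributions[OF \<sigma> \<tau>] .
    have "p1 (i - 2) (connecting_path \<tau> (Min (contributions z \<sigma> j \<tau>)) (Max (contributions z \<sigma> j \<tau>))) =
        unit_vec (\<tau>, Min (contributions z \<sigma> j \<tau>)) + unit_vec (\<tau>, Max (contributions z \<sigma> j \<tau>))"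
      using g by (intro p1_path) (auto simp: gens_iff)
    \<comment> \<open>Sorting the two positions at most swaps the summands; if the positions
      coincide, both sides are 0.\<close>
    also have "\<dots> = ?u \<rho>1 \<tau> + ?u \<rho>2 \<tau>"
      unfolding c by (auto simp: min_def max_def add.commute)
    finally show ?thesis using \<rho> by simp
  qed
  have "f0 (i - 1) (f0 i (unit_vec b)) = (\<Sum>\<rho>\<in>facets \<sigma>. \<Sum>\<tau>\<in>facets \<rho>. ?u \<rho> \<tau>)"
    using b unfolding bj by (simp add: f0_unit map_sum facet_gen_basis)
  \<comment> \<open>Indexing the inner sum by codimension-2 faces of \<open>\<sigma>\<close> allows
    the order of summation to be exchanged and the two routes to each face to be collected.\<close>
  also have "\<dots> = (\<Sum>\<rho>\<in>facets \<sigma>. \<Sum>\<tau>\<in>{\<tau> \<in> codim2_faces \<sigma>. \<tau> \<in> facets \<rho>}. ?u \<rho> \<tau>)"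
    by (intro sum.cong refl) (use facet_of_facet in blast)
  also have "\<dots> = (\<Sum>\<tau>\<in>codim2_faces \<sigma>. \<Sum>\<rho>\<in>{\<rho> \<in> facets \<sigma>. \<tau> \<in> facets \<rho>}. ?u \<rho> \<tau>)"
    using fin by (intro sum.swap_restrict finite_facets finite_codim2_faces)
  also have "\<dots> = p1 (i - 2) (h0 i (unit_vec b))"
    using b unfolding bj by (simp add: h0_unit map_sum codim2)
  finally show "f0 (i - 1) (f0 i (unit_vec b)) = p1 (i - 2) (h0 i (unit_vec b))" .
qed

text \<open>Under \<open>p1\<close> both sides become \<open>f0 f0 f0\<close>, with
  \<open>p1 h0\<close> replacing the left pair on one side and the right pair on the other.\<close>

lemma h0_f0:
  assumes v: "v \<in> vecs (gens i s)"
  shows "h0 (i - 1) (f0 i v) = f1 (i - 2) (h0 i v)"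
proof (rule p1_inject)
  show "h0 (i - 1) (f0 i v) \<in> vecs (rels (i - 3) s)"
    using h0_vecs[OF f0_vecs[OF v]] by (simp add: diff_diff_eq)
  show "f1 (i - 2) (h0 i v) \<in> vecs (rels (i - 3) s)"
    using f1_vecs[OF h0_vecs[OF v]] by (simp add: diff_diff_eq)
  have "p1 (i - 3) (h0 (i - 1) (f0 i v)) = f0 (i - 2) (f0 (i - 1) (f0 i v))"
    using f0_f0[OF gens_vecs[OF f0_vecs[OF v]]] by (simp add: diff_diff_eq)
  also have "\<dots> = f0 (i - 2) (p1 (i - 2) (h0 i v))"
    by (simp add: f0_f0[OF gens_vecs[OF v]])
  also have "\<dots> = p1 (i - 3) (f1 (i - 2) (h0 i v))"
    using f0_p1[OF rels_vecs[OF h0_vecs[OF v]]] by (simp add: diff_diff_eq)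
  finally show "p1 (i - 3) (h0 (i - 1) (f0 i v)) = p1 (i - 3) (f1 (i - 2) (h0 i v))" .
qed

text \<open>Under \<open>p1\<close> both sides become \<open>f0 f0 p1\<close>, on the right by
  moving \<open>p1\<close> past \<open>f1\<close> twice.\<close>

lemma h0_p1:
  assumes v: "v \<in> vecs (rels i s)"
  shows "h0 i (p1 i v) = f1 (i - 1) (f1 i v)"
proof (rule p1_inject)
  show "h0 i (p1 i v) \<in> vecs (rels (i - 2) s)"
    by (rule h0_vecs[OF p1_vecs[OF v]])
  show "f1 (i - 1) (f1 i v) \<in> vecs (rels (i - 2) s)"
    using f1_vecs[OF f1_vecs[OF v]] by (simp add: diff_diff_eq)
  have "p1 (i - 2) (h0 i (p1 i v)) = f0 (i - 1) (f0 i (p1 i v))"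
    by (simp add: f0_f0[OF gens_vecs[OF p1_vecs[OF v]]])
  also have "\<dots> = f0 (i - 1) (p1 (i - 1) (f1 i v))"
    by (simp add: f0_p1[OF rels_vecs[OF v]])
  also have "\<dots> = p1 (i - 2) (f1 (i - 1) (f1 i v))"
    using f0_p1[OF rels_vecs[OF f1_vecs[OF v]]] by (simp add: diff_diff_eq)
  finally show "p1 (i - 2) (h0 i (p1 i v)) = p1 (i - 2) (f1 (i - 1) (f1 i v))" .
qed

text \<open>Lift \<open>c\<close> to generators: there the double differential lies in the image of
  \<open>p1\<close>, which \<open>\<epsilon>\<close> kills.\<close>

lemma bd_bd:
  assumes c: "c \<in> vecs (cells i s)"
  shows "bd (i - 1) (bd i c) = 0"
proof -
  obtain g where g: "g \<in> vecs (gens i s)" "\<epsilon> i g = c" using \<epsilon>_surj[OF c] .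
  have "bd (i - 1) (bd i c) = \<epsilon> (i - 2) (f0 (i - 1) (f0 i g))"
    using \<epsilon>_f0[OF gens_vecs[OF g(1)]] \<epsilon>_f0[OF gens_vecs[OF f0_vecs[OF g(1)]]] g(2)
    by (simp add: diff_diff_eq)
  also have "\<dots> = 0"
    by (simp add: f0_f0[OF gens_vecs[OF g(1)]] \<epsilon>_p1[OF rels_vecs[OF h0_vecs[OF g(1)]]])
  finally show ?thesis .
qed

section \<open>The path complex and the bifiltered complex as chain complexes\<close>

abbreviation "F \<equiv> path_complex K Ks z"
abbreviation "C \<equiv> bifiltered_complex K Ks"

lemma cdiff_F: "cdiff F i s (g, r) = (f0 i g + p1 (i - 1) r, h0 i g + f1 (i - 1) r)"
  unfolding path_complex_def by simp

lemma cdiff_C: "cdiff C i s = bd i"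
  unfolding bifiltered_complex_def bd_def by simp

lemma carrier_F: "carrier (obj (cmod F i) s) = vecs (gens i s) \<times> vecs (rels (i - 1) s)"
  unfolding path_complex_def direct_sum2_def gen_module_def rel_module_def gens_def rels_def
  by (simp add: carrier_free_on finite_gen_basis finite_rel_basis)

lemma carrier_C: "carrier (obj (cmod C i) s) = vecs (cells i s)"
  unfolding bifiltered_complex_def cells_def
  by (simp add: carrier_direct_sum_upset_finite finite_simplices)

lemma inclusion_F: "inclusion_module (cmod F i)"
  unfolding path_complex_def gen_module_def rel_module_def free_on_def
  by (simp add: inclusion_direct_sum2 inclusion_direct_sum_upset)

lemma inclusion_C: "inclusion_module (cmod C i)"
  unfolding bifiltered_complex_def by (simp add: inclusion_direct_sum_upset)

lemma cdiff_F_closed: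
  assumes "x \<in> carrier (obj (cmod F i) s)"
  shows "cdiff F i s x \<in> carrier (obj (cmod F (i - 1)) s)"
proof -
  obtain g r where x: "x = (g, r)" "g \<in> vecs (gens i s)" "r \<in> vecs (rels (i - 1) s)"
    using assms unfolding carrier_F by blast
  show ?thesis
    using f0_vecs[OF x(2)] p1_vecs[OF x(3)] h0_vecs[OF x(2)] f1_vecs[OF x(3)]
    unfolding carrier_F x(1) cdiff_F by (simp add: vecs_add diff_diff_eq)
qed

text \<open>In the first component \<open>f0 f0\<close> cancels \<open>p1 h0\<close> and
  \<open>f0 p1\<close> cancels \<open>p1 f1\<close>; in the second \<open>h0 f0\<close> cancels
  \<open>f1 h0\<close> and \<open>h0 p1\<close> cancels \<open>f1 f1\<close>.\<close>

lemma cdiff_F_F: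
  assumes "x \<in> carrier (obj (cmod F i) s)"
  shows "cdiff F (i - 1) s (cdiff F i s x) = 0"
proof -
  obtain g r where x: "x = (g, r)" "g \<in> vecs (gens i s)" "r \<in> vecs (rels (i - 1) s)"
    using assms unfolding carrier_F by blast
  have "f0 (i - 1) (f0 i g + p1 (i - 1) r) + p1 (i - 2) (h0 i g + f1 (i - 1) r) = 0"
    using f0_f0[OF gens_vecs[OF x(2)]] f0_p1[OF rels_vecs[OF x(3)]]
    by (simp add: map_add vec_add_eq_0_iff diff_diff_eq)
  moreover have "h0 (i - 1) (f0 i g + p1 (i - 1) r) + f1 (i - 2) (h0 i g + f1 (i - 1) r) = 0"
    using h0_f0[OF x(2)] h0_p1[OF x(3)] by (simp add: map_add vec_add_eq_0_iff diff_diff_eq)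
  ultimately show ?thesis
    unfolding x(1) cdiff_F by (simp add: zero_prod_def diff_diff_eq)
qed

lemma chain_complex_F: "chain_complex F"
  unfolding chain_complex_def pmorphism_inclusion[OF inclusion_F inclusion_F]
    inclusion_moduleD(3)[OF inclusion_F]
proof (intro conjI allI ballI impI)
  fix i s t x y
  show "bipersistence_module (cmod F i)" by (rule bipersistence_module_inclusion[OF inclusion_F])
  assume x: "x \<in> carrier (obj (cmod F i) s)"
  show "cdiff F i s x \<in> carrier (obj (cmod F (i - 1)) s)" by (rule cdiff_F_closed[OF x])
  show "cdiff F (i - 1) s (cdiff F i s x) = 0" by (rule cdiff_F_F[OF x])
  show "cdiff F i t x = cdiff F i s x" by (cases x) (simp add: cdiff_F)
  show "cdiff F i s (x + y) = cdiff F i s x + cdiff F i s y"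
    by (cases x; cases y) (simp add: cdiff_F map_add add_ac)
qed

lemma chain_complex_C: "chain_complex C"
  unfolding chain_complex_def pmorphism_inclusion[OF inclusion_C inclusion_C]
    inclusion_moduleD(3)[OF inclusion_C] carrier_C cdiff_C
  using bipersistence_module_inclusion[OF inclusion_C] bd_vecs bd_bd by (auto simp: map_add)

section \<open>The augmentation is a quasi-isomorphism\<close>

abbreviation augmentation :: "int \<Rightarrow> grade \<Rightarrow> ('v set \<times> nat \<Rightarrow> bit) \<times> ('v set \<times> nat \<Rightarrow> bit) \<Rightarrow> 'v set \<Rightarrow> bit" where
  "augmentation i s x \<equiv> \<epsilon> i (fst x)"

lemma chain_map_augmentation: "chain_map F C augmentation"
  unfolding chain_map_def pmorphism_inclusion[OF inclusion_F inclusion_C]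
proof (intro conjI allI ballI impI chain_complex_F chain_complex_C)
  fix i s t x y
  assume x: "x \<in> carrier (obj (cmod F i) s)"
  then obtain g r where gr: "x = (g, r)" "g \<in> vecs (gens i s)" "r \<in> vecs (rels (i - 1) s)"
    unfolding carrier_F by blast
  show "\<epsilon> i (fst x) \<in> carrier (obj (cmod C i) s)"
    unfolding carrier_C using gr by (simp add: \<epsilon>_vecs)
  show "\<epsilon> i (fst (x + y)) = \<epsilon> i (fst x) + \<epsilon> i (fst y)" by (simp add: map_add)
  show "\<epsilon> (i - 1) (fst (cdiff F i s x)) = cdiff C i s (\<epsilon> i (fst x))"
    unfolding gr(1) cdiff_C cdiff_F
    by (simp add: map_add \<epsilon>_f0[OF gens_vecs[OF gr(2)]] \<epsilon>_p1[OF rels_vecs[OF gr(3)]])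
qed simp

text \<open>For a lift \<open>g\<close> of \<open>c\<close>, the vector \<open>f0 i g\<close> lies
  in the kernel of \<open>\<epsilon>\<close> and is thus the \<open>p1\<close>-image of some
  \<open>r\<close>; then \<open>(g, r)\<close> is the required cycle.\<close>

lemma cycle_lift:
  assumes "c \<in> cycles C i s"
  shows "\<exists>x\<in>cycles F i s. \<epsilon> i (fst x) = c"
proof -
  interpret F: inclusion_complex F by unfold_locales (rule inclusion_F chain_complex_F)+
  interpret C: inclusion_complex C by unfold_locales (rule inclusion_C chain_complex_C)+
  have c: "c \<in> vecs (cells i s)" "bd i c = 0"
    using assms by (simp_all add: C.mem_cycles carrier_C cdiff_C)
  obtain g where g: "g \<in> vecs (gens i s)" "\<epsilon> i g = c" using \<epsilon>_surj[OF c(1)] .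
  have zero: "\<epsilon> (i - 1) (f0 i g) = 0" using \<epsilon>_f0[OF gens_vecs[OF g(1)]] g(2) c(2) by simp
  obtain r where r: "r \<in> vecs (rels (i - 1) s)" "p1 (i - 1) r = f0 i g"
    using \<epsilon>_kernel[OF f0_vecs[OF g(1)] zero] .
  \<comment> \<open>The relation component of the cycle condition is automatic: under
    \<open>p1\<close> both sides become \<open>f0 f0 g\<close>.\<close>
  have "h0 i g = f1 (i - 1) r"
  proof (rule p1_inject)
    show "h0 i g \<in> vecs (rels (i - 2) s)" by (rule h0_vecs[OF g(1)])
    show "f1 (i - 1) r \<in> vecs (rels (i - 2) s)" using f1_vecs[OF r(1)] by (simp add: diff_diff_eq)
    show "p1 (i - 2) (h0 i g) = p1 (i - 2) (f1 (i - 1) r)"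
      using f0_f0[OF gens_vecs[OF g(1)]] f0_p1[OF rels_vecs[OF r(1)]] r(2) by (simp add: diff_diff_eq)
  qed
  then have "(g, r) \<in> cycles F i s"
    unfolding F.mem_cycles carrier_F cdiff_F using g(1) r by (simp add: zero_prod_def)
  with g(2) show ?thesis by force
qed

text \<open>Lift a bounding chain to \<open>g'\<close>. Then \<open>g\<close> and
  \<open>f0 (i + 1) g'\<close> have the same augmentation, so they differ by some
  \<open>p1 i r'\<close>, and \<open>(g', r')\<close> bounds \<open>x\<close>.\<close>

lemma boundary_lift:
  assumes "x \<in> cycles F i s" and "\<epsilon> i (fst x) \<in> boundaries C i s"
  shows "x \<in> boundaries F i s"
proof -
  interpret F: inclusion_complex F by unfold_locales (rule inclusion_F chain_complex_F)+
  obtain g r where x: "x = (g, r)" by (cases x)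
  have g: "g \<in> vecs (gens i s)" and r: "r \<in> vecs (rels (i - 1) s)"
    and cyc: "h0 i g = f1 (i - 1) r" "f0 i g = p1 (i - 1) r"
    using assms(1) by (simp_all add: F.mem_cycles carrier_F cdiff_F x zero_prod_def vec_add_eq_0_iff)
  obtain c where c: "c \<in> vecs (cells (i + 1) s)" "\<epsilon> i g = bd (i + 1) c"
    using assms(2) by (auto simp: boundaries_def carrier_C cdiff_C x)
  obtain g' where g': "g' \<in> vecs (gens (i + 1) s)" "\<epsilon> (i + 1) g' = c" using \<epsilon>_surj[OF c(1)] .
  have f0g': "f0 (i + 1) g' \<in> vecs (gens i s)" using f0_vecs[OF g'(1)] by simp
  have zero: "\<epsilon> i (g + f0 (i + 1) g') = 0"
    using \<epsilon>_f0[OF gens_vecs[OF g'(1)]] g'(2) c(2) by (simp add: map_add)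
  obtain r' where r': "r' \<in> vecs (rels i s)" "p1 i r' = g + f0 (i + 1) g'"
    using \<epsilon>_kernel[OF vecs_add[OF g f0g'] zero] .
  have g_eq: "g = f0 (i + 1) g' + p1 i r'" unfolding r'(2) by (simp add: add_ac)
  \<comment> \<open>Again injectivity of \<open>p1\<close> settles the relation component:
    \<open>p1 (i - 1) r\<close> is \<open>f0 i g\<close> by the cycle condition, and
    \<open>g_eq\<close> expands it.\<close>
  have "r = h0 (i + 1) g' + f1 i r'"
  proof (rule p1_inject[OF r vecs_add])
    show "h0 (i + 1) g' \<in> vecs (rels (i - 1) s)" using h0_vecs[OF g'(1)] by simp
    show "f1 i r' \<in> vecs (rels (i - 1) s)" by (rule f1_vecs[OF r'(1)])
    have "p1 (i - 1) r = f0 i (f0 (i + 1) g') + f0 i (p1 i r')"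
      unfolding cyc(2)[symmetric] by (subst g_eq) (simp add: map_add)
    then show "p1 (i - 1) r = p1 (i - 1) (h0 (i + 1) g' + f1 i r')"
      using f0_f0[OF gens_vecs[OF g'(1)]] f0_p1[OF rels_vecs[OF r'(1)]] by (simp add: map_add)
  qed
  then have "x = cdiff F (i + 1) s (g', r')" unfolding cdiff_F x using g_eq by simp
  moreover have "(g', r') \<in> carrier (obj (cmod F (i + 1)) s)"
    unfolding carrier_F using g'(1) r'(1) by simp
  ultimately show ?thesis unfolding boundaries_def by blast
qed

lemma free_F: "free_pmodule (cmod F i)"
  unfolding path_complex_def gen_module_def rel_module_def
  by (simp add: free_pmodule_direct_sum2 finite_gen_basis finite_rel_basis)

lemma free_resolution_path_complex: "free_resolution F C"
proof -
  have "pisomorphism (homology F i) (homology C i) (homology_map C augmentation i)" for i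
    by (rule homology_isomorphismI[OF inclusion_F inclusion_C chain_map_augmentation])
      (simp_all add: cycle_lift boundary_lift)
  then show ?thesis
    unfolding free_resolution_def using chain_complex_F free_F chain_map_augmentation by blast
qed

end

theorem theorem2:
  fixes K :: "'v set set"
    and Ks :: "grade \<Rightarrow> 'v set set"
    and z :: "'v set \<Rightarrow> nat \<Rightarrow> 'v set \<Rightarrow> nat"
  assumes "simplicial_bifiltration K Ks"
    and "facet_choice K Ks z"
  shows "free_resolution (path_complex K Ks z) (bifiltered_complex K Ks)"
proof -
  interpret path_construction K Ks z by unfold_locales (rule assms)+
  show ?thesis by (rule free_resolution_path_complex)
qed

end
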